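(* Let $M$ be a Hausdorff manifold, let $C$ be a coalgebra over $R=\mathcal{C}^{\infty}_{c}(M)$, and let $x\in M$. Then: (i) If $c\in G_{w}(C)$ is normalized at $x$, then $c_{x}\in G(C_{x})$. (ii) If $c,d\in G_{w}(C)$ are normalized on open neighbourhoods $U$ respectively $V$ of $x$ and if $c_{x}=d_{x}$, then there exists an open neighbourhood $W\subset U\cap V$ of $x$ such that $c_{y}=d_{y}$ for any $y\in W$. (iii) If $c$ is an element of $C$ such that $c_{x}\in G(C_{x})$, then $c$ is normalized on an open neighbourhood $U$ of $x$, and there exists $f\in\mathcal{C}^{\infty}_{c}(U)$ with $f_{x}=1$ such that $fc\in G_{w}(C)$.
   Context: $\mathcal{C}^{\infty}_{c}(M)$ is the ring of smooth $\mathbb{F}$-valued ($\mathbb{F}\in\{\mathbb{R},\mathbb{C}\}$ fixed) functions with compact support on $M$; "$f_{x}=1$" means that the germ of $f$ at $x$ is that of the constant $1$. A left $R$-module $C$ is locally unitary if for all $c_{1},\dots,c_{k}\in C$ there is $r\in R$ with $rc_{i}=c_{i}$ for all $i$. A coalgebra over $R$ is a locally unitary $R$-module $C$ with $R$-linear maps $\Delta:C\to C\otimes_{R}C$ and $\epsilon:C\to R$ with $(\mathrm{id}\otimes\epsilon)\circ\Delta=\mathrm{id}=(\epsilon\otimes\mathrm{id})\circ\Delta$ (coassociativity and cocommutativity are not assumed). An element $c\in C$ is weakly grouplike if $\Delta(c)=c\otimes c'$ for some $c'\in C$; $G_{w}(C)$ is the set of these. For $x\in M$, put $N_{x}(C)=\{c\in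 C: fc=0$ for some $f\in\mathcal{C}^{\infty}_{c}(M)$ with $f_{x}=1\}$, $C_{x}=C/N_{x}(C)$, $c_{x}=c+N_{x}(C)$. With the maps $\Delta_{x},\epsilon_{x}$ induced by $\Delta,\epsilon$ (using the canonical identification $(C\otimes_{R}C)_{x}=C_{x}\otimes_{R_{x}}C_{x}$), $C_{x}$ is a coalgebra over the ring of germs $R_{x}=(\mathcal{C}^{\infty}_{M})_{x}$, and $G(C_{x})=\{\zeta\in C_{x}:\Delta_{x}(\zeta)=\zeta\otimes\zeta,\ \epsilon_{x}(\zeta)=1\}$. An element $c\in C$ is normalized at $x$ if $\epsilon(c)_{x}=1$ (germ at $x$), and normalized on $W\subset M$ if normalized at every point of $W$. *)

theory Defs
  imports "HOL-Analysis.Analysis" "HOL-Algebra.Module" "HOL-Algebra.AbelCoset"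
    "HOL-Algebra.Generated_Groups" "HOL-Algebra.Free_Abelian_Groups"
begin

section \<open>Smooth manifolds and smooth functions\<close>

text \<open>The model space \<open>E\<close> is a linear subspace of a Euclidean space. The class
  \<^class>\<open>euclidean_space\<close> has no 0-dimensional instance; with a subspace \<open>E\<close>, manifolds of
  every dimension, 0 included, are covered. In the following, \<open>S\<close> is an open subset of \<open>E\<close>.
  The derivative at a point of \<open>S\<close> is unique on \<open>E\<close> only, which is why just the directions
  in \<open>E\<close> are differentiated further.\<close>

primrec Ck_on :: "nat \<Rightarrow> 'e::euclidean_space set \<Rightarrow> 'e set \<Rightarrow> ('e \<Rightarrow> 'b::real_normed_vector) \<Rightarrow> bool"
where
  "Ck_on 0 E S f \<longleftrightarrow> continuous_on S f"
| "Ck_on (Suc k) E S f \<longleftrightarrow>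
     (\<exists>f'. (\<forall>p\<in>S. (f has_derivative f' p) (at p within S)) \<and>
           (\<forall>v\<in>E. Ck_on k E S (\<lambda>p. f' p v)))"

definition Cinf_on :: "'e::euclidean_space set \<Rightarrow> 'e set \<Rightarrow> ('e \<Rightarrow> 'b::real_normed_vector) \<Rightarrow> bool"
  where "Cinf_on E S f \<longleftrightarrow> (\<forall>k. Ck_on k E S f)"

text \<open>A chart is a pair of its domain and its coordinate map (relevant on the domain only).\<close>

type_synonym ('m, 'e) atlas = "('m set \<times> ('m \<Rightarrow> 'e)) set"

text \<open>The manifold is the whole type \<open>'m\<close> with its topology. It is Hausdorff if \<open>'m\<close> is of
  class \<^class>\<open>t2_space\<close>; second countability is not required.\<close>

definition smooth_manifold ::
  "'e::euclidean_space set \<Rightarrow> ('m::topological_space, 'e) atlas \<Rightarrow> bool"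
  where "smooth_manifold E A \<longleftrightarrow>
     subspace E \<and>
     (\<Union>(U, \<phi>)\<in>A. U) = UNIV \<and>
     (\<forall>(U, \<phi>)\<in>A. open U \<and> openin (top_of_set E) (\<phi> ` U) \<and>
        homeomorphism U (\<phi> ` U) \<phi> (inv_into U \<phi>)) \<and>
     (\<forall>(U, \<phi>)\<in>A. \<forall>(V, \<psi>)\<in>A. Cinf_on E (\<phi> ` (U \<inter> V)) (\<psi> \<circ> inv_into U \<phi>))"

text \<open>The scalar field is a set \<open>F\<close> of complex numbers, to be taken as \<open>\<real>\<close> or as all of
  the complex numbers.\<close>

definition smooth_functions ::
  "complex set \<Rightarrow> 'e::euclidean_space set \<Rightarrow> ('m::topological_space, 'e) atlas \<Rightarrow> 'm set
    \<Rightarrow> ('m \<Rightarrow> complex) set"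
  where "smooth_functions F E A W =
     {f. (\<forall>y\<in>W. f y \<in> F) \<and> (\<forall>(U, \<phi>)\<in>A. Cinf_on E (\<phi> ` (U \<inter> W)) (f \<circ> inv_into U \<phi>))}"

text \<open>\<open>\<C>\<^sup>\<infinity>\<^sub>c(U)\<close>, functions being extended by zero to the whole manifold.\<close>

definition smooth_compact ::
  "complex set \<Rightarrow> 'e::euclidean_space set \<Rightarrow> ('m::topological_space, 'e) atlas \<Rightarrow> 'm set
    \<Rightarrow> ('m \<Rightarrow> complex) set"
  where "smooth_compact F E A U =
     {f \<in> smooth_functions F E A UNIV.
        compact (closure {y. f y \<noteq> 0}) \<and> closure {y. f y \<noteq> 0} \<subseteq> U}"

text \<open>The ring \<open>\<C>\<^sup>\<infinity>\<^sub>c(M)\<close>, presented as a module over itself. The field \<open>one\<close> belongs to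
  the carrier only if the manifold is compact and is never used.\<close>

definition smooth_compact_ring ::
  "complex set \<Rightarrow> 'e::euclidean_space set \<Rightarrow> ('m::topological_space, 'e) atlas
    \<Rightarrow> ('m \<Rightarrow> complex, 'm \<Rightarrow> complex) module"
  where "smooth_compact_ring F E A =
     \<lparr>carrier = smooth_compact F E A UNIV,
      mult = (\<lambda>f g y. f y * g y), one = (\<lambda>y. 1),
      ring.zero = (\<lambda>y. 0), add = (\<lambda>f g y. f y + g y),
      smult = (\<lambda>f g y. f y * g y)\<rparr>"

definition germ :: "'m::topological_space \<Rightarrow> ('m \<Rightarrow> 'b) \<Rightarrow> ('m \<Rightarrow> 'b) set"
  where "germ x f = {g. eventually (\<lambda>y. g y = f y) (nhds x)}"

text \<open>The set of elements of the ring \<open>R\<^sub>x\<close> of germs at \<open>x\<close> of smooth functions.\<close>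

definition smooth_germs ::
  "complex set \<Rightarrow> 'e::euclidean_space set \<Rightarrow> ('m::topological_space, 'e) atlas \<Rightarrow> 'm
    \<Rightarrow> ('m \<Rightarrow> complex) set set"
  where "smooth_germs F E A x =
     {germ x f | f U. open U \<and> x \<in> U \<and> f \<in> smooth_functions F E A U}"


section \<open>Tensor products\<close>

text \<open>Here \<open>S\<close> is the set of elements of a commutative, not necessarily unital, ring. The tensor
  product is the free abelian group on \<open>A \<times> B\<close> modulo the subgroup generated by the
  relations of a biadditive \<open>S\<close>-balanced map.\<close>

definition tensor_free :: "('r, 'a) module \<Rightarrow> ('r, 'b) module \<Rightarrow> ('a \<times> 'b \<Rightarrow>\<^sub>0 int) monoid"
  where "tensor_free A B = free_Abelian_group (carrier A \<times> carrier B)"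

definition tensor_relations ::
  "'r set \<Rightarrow> ('r, 'a) module \<Rightarrow> ('r, 'b) module \<Rightarrow> ('a \<times> 'b \<Rightarrow>\<^sub>0 int) set"
  where "tensor_relations S A B =
     {frag_of (a \<oplus>\<^bsub>A\<^esub> a', b) - frag_of (a, b) - frag_of (a', b) | a a' b.
        a \<in> carrier A \<and> a' \<in> carrier A \<and> b \<in> carrier B} \<union>
     {frag_of (a, b \<oplus>\<^bsub>B\<^esub> b') - frag_of (a, b) - frag_of (a, b') | a b b'.
        a \<in> carrier A \<and> b \<in> carrier B \<and> b' \<in> carrier B} \<union>
     {frag_of (r \<odot>\<^bsub>A\<^esub> a, b) - frag_of (a, r \<odot>\<^bsub>B\<^esub> b) | r a b.
        r \<in> S \<and> a \<in> carrier A \<and> b \<in> carrier B}"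

definition tensor_null ::
  "'r set \<Rightarrow> ('r, 'a) module \<Rightarrow> ('r, 'b) module \<Rightarrow> ('a \<times> 'b \<Rightarrow>\<^sub>0 int) set"
  where "tensor_null S A B = generate (tensor_free A B) (tensor_relations S A B)"

definition tensor_class ::
  "'r set \<Rightarrow> ('r, 'a) module \<Rightarrow> ('r, 'b) module \<Rightarrow> ('a \<times> 'b \<Rightarrow>\<^sub>0 int) \<Rightarrow> ('a \<times> 'b \<Rightarrow>\<^sub>0 int) set"
  where "tensor_class S A B u = tensor_null S A B #>\<^bsub>tensor_free A B\<^esub> u"

definition pure_tensor ::
  "'r set \<Rightarrow> ('r, 'a) module \<Rightarrow> ('r, 'b) module \<Rightarrow> 'a \<Rightarrow> 'b \<Rightarrow> ('a \<times> 'b \<Rightarrow>\<^sub>0 int) set"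
  where "pure_tensor S A B a b = tensor_class S A B (frag_of (a, b))"

text \<open>The map \<open>f \<otimes> g\<close> into \<open>A' \<otimes> B'\<close>. Whenever \<open>f \<otimes> g\<close> is well defined, the classes in
  the union, one for each representative \<open>u\<close> of the tensor \<open>t\<close>, are all equal.\<close>

definition tensor_map ::
  "'s set \<Rightarrow> ('s, 'c) module \<Rightarrow> ('s, 'd) module \<Rightarrow> ('a \<Rightarrow> 'c) \<Rightarrow> ('b \<Rightarrow> 'd)
    \<Rightarrow> ('a \<times> 'b \<Rightarrow>\<^sub>0 int) set \<Rightarrow> ('c \<times> 'd \<Rightarrow>\<^sub>0 int) set"
  where "tensor_map S A' B' f g t =
     (\<Union>u\<in>t. tensor_class S A' B' (frag_extend (\<lambda>(a, b). frag_of (f a, g b)) u))"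

definition tensor ::
  "'r set \<Rightarrow> ('r, 'a) module \<Rightarrow> ('r, 'b) module \<Rightarrow> ('r, ('a \<times> 'b \<Rightarrow>\<^sub>0 int) set) module"
  where "tensor S A B =
     \<lparr>carrier = carrier (tensor_free A B Mod tensor_null S A B),
      mult = undefined, one = undefined,
      ring.zero = monoid.one (tensor_free A B Mod tensor_null S A B),
      add = monoid.mult (tensor_free A B Mod tensor_null S A B),
      smult = (\<lambda>r. tensor_map S A B (\<lambda>a. r \<odot>\<^bsub>A\<^esub> a) (\<lambda>b. b))\<rparr>"

text \<open>The map on a tensor product into \<open>D\<close> induced by a biadditive balanced map \<open>\<beta>\<close>.\<close>

definition tensor_lift ::
  "('r, 'd) module \<Rightarrow> ('a \<Rightarrow> 'b \<Rightarrow> 'd) \<Rightarrow> ('a \<times> 'b \<Rightarrow>\<^sub>0 int) set \<Rightarrow> 'd"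
  where "tensor_lift D \<beta> t =
     the_elem ((\<lambda>u. finsum D (\<lambda>(a, b). [Poly_Mapping.lookup u (a, b)] \<cdot>\<^bsub>D\<^esub> \<beta> a b)
                      (Poly_Mapping.keys u)) ` t)"


section \<open>Coalgebras\<close>

text \<open>Modules over a commutative ring \<open>R\<close> without unit; the ring is given as a module over
  itself.\<close>

locale locally_unitary_module = abelian_group C
  for R :: "('r, 'r) module" and C :: "('r, 'c) module" +
  assumes smult_closed: "\<lbrakk>r \<in> carrier R; c \<in> carrier C\<rbrakk> \<Longrightarrow> r \<odot>\<^bsub>C\<^esub> c \<in> carrier C"
    and smult_l_distr: "\<lbrakk>r \<in> carrier R; s \<in> carrier R; c \<in> carrier C\<rbrakk> \<Longrightarrow>
          (r \<oplus>\<^bsub>R\<^esub> s) \<odot>\<^bsub>C\<^esub> c = r \<odot>\<^bsub>C\<^esub> c \<oplus>\<^bsub>C\<^esub> s \<odot>\<^bsub>C\<^esub> c"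
    and smult_r_distr: "\<lbrakk>r \<in> carrier R; c \<in> carrier C; d \<in> carrier C\<rbrakk> \<Longrightarrow>
          r \<odot>\<^bsub>C\<^esub> (c \<oplus>\<^bsub>C\<^esub> d) = r \<odot>\<^bsub>C\<^esub> c \<oplus>\<^bsub>C\<^esub> r \<odot>\<^bsub>C\<^esub> d"
    and smult_assoc: "\<lbrakk>r \<in> carrier R; s \<in> carrier R; c \<in> carrier C\<rbrakk> \<Longrightarrow>
          (r \<otimes>\<^bsub>R\<^esub> s) \<odot>\<^bsub>C\<^esub> c = r \<odot>\<^bsub>C\<^esub> (s \<odot>\<^bsub>C\<^esub> c)"
    and locally_unitary: "\<lbrakk>finite K; K \<subseteq> carrier C\<rbrakk> \<Longrightarrow>
          \<exists>r\<in>carrier R. \<forall>c\<in>K. r \<odot>\<^bsub>C\<^esub> c = c"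

definition module_linear ::
  "'r set \<Rightarrow> ('r, 'a) module \<Rightarrow> ('r, 'b) module \<Rightarrow> ('a \<Rightarrow> 'b) \<Rightarrow> bool"
  where "module_linear S A B h \<longleftrightarrow>
     (\<forall>a\<in>carrier A. h a \<in> carrier B) \<and>
     (\<forall>a\<in>carrier A. \<forall>b\<in>carrier A. h (a \<oplus>\<^bsub>A\<^esub> b) = h a \<oplus>\<^bsub>B\<^esub> h b) \<and>
     (\<forall>r\<in>S. \<forall>a\<in>carrier A. h (r \<odot>\<^bsub>A\<^esub> a) = r \<odot>\<^bsub>B\<^esub> h a)"

text \<open>In the counit laws, \<open>C \<otimes> R\<close> and \<open>R \<otimes> C\<close> are identified with \<open>C\<close> by
  \<open>c \<otimes> r \<mapsto> r c\<close> and \<open>r \<otimes> c \<mapsto> r c\<close>.\<close>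

locale coalgebra = locally_unitary_module R C
  for R :: "('r, 'r) module" and C :: "('r, 'c) module" +
  fixes \<Delta> :: "'c \<Rightarrow> ('c \<times> 'c \<Rightarrow>\<^sub>0 int) set" and \<epsilon> :: "'c \<Rightarrow> 'r"
  assumes comult_linear: "module_linear (carrier R) C (tensor (carrier R) C C) \<Delta>"
    and counit_linear: "module_linear (carrier R) C R \<epsilon>"
    and counit_right: "c \<in> carrier C \<Longrightarrow>
          tensor_lift C (\<lambda>c r. r \<odot>\<^bsub>C\<^esub> c) (tensor_map (carrier R) C R (\<lambda>a. a) \<epsilon> (\<Delta> c)) = c"
    and counit_left: "c \<in> carrier C \<Longrightarrow>
          tensor_lift C (\<lambda>r c. r \<odot>\<^bsub>C\<^esub> c) (tensor_map (carrier R) R C \<epsilon> (\<lambda>a. a) (\<Delta> c)) = c"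

definition weakly_grouplike ::
  "('r, 'r) module \<Rightarrow> ('r, 'c) module \<Rightarrow> ('c \<Rightarrow> ('c \<times> 'c \<Rightarrow>\<^sub>0 int) set) \<Rightarrow> 'c set"
  where "weakly_grouplike R C \<Delta> =
     {c \<in> carrier C. \<exists>c'\<in>carrier C. \<Delta> c = pure_tensor (carrier R) C C c c'}"

definition normalized_on ::
  "('c \<Rightarrow> 'm::topological_space \<Rightarrow> complex) \<Rightarrow> 'c \<Rightarrow> 'm set \<Rightarrow> bool"
  where "normalized_on \<epsilon> c W \<longleftrightarrow> (\<forall>y\<in>W. germ y (\<epsilon> c) = germ y (\<lambda>_. 1))"


section \<open>Localization at a point\<close>

text \<open>From here on, \<open>R\<close> is a ring of functions on a topological space. In this section, unions
  indexed by the elements of a coset are unions over representatives and have equal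
  members whenever the map in question is well defined.\<close>

definition stalk_null ::
  "('m::topological_space \<Rightarrow> complex, 'm \<Rightarrow> complex) module \<Rightarrow> 'm
    \<Rightarrow> ('m \<Rightarrow> complex, 'c) module \<Rightarrow> 'c set"
  where "stalk_null R x C =
     {c \<in> carrier C. \<exists>f\<in>carrier R. germ x f = germ x (\<lambda>_. 1) \<and> f \<odot>\<^bsub>C\<^esub> c = \<zero>\<^bsub>C\<^esub>}"

definition stalk_elt ::
  "('m::topological_space \<Rightarrow> complex, 'm \<Rightarrow> complex) module \<Rightarrow> 'm
    \<Rightarrow> ('m \<Rightarrow> complex, 'c) module \<Rightarrow> 'c \<Rightarrow> 'c set"
  where "stalk_elt R x C c = stalk_null R x C +>\<^bsub>C\<^esub> c"

text \<open>The germ of \<open>f \<in> R\<close> at \<open>x\<close> acts on the class of \<open>c\<close> by giving the class of \<open>f c\<close>.\<close>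

definition stalk ::
  "('m::topological_space \<Rightarrow> complex, 'm \<Rightarrow> complex) module \<Rightarrow> 'm
    \<Rightarrow> ('m \<Rightarrow> complex, 'c) module \<Rightarrow> (('m \<Rightarrow> complex) set, 'c set) module"
  where "stalk R x C =
     \<lparr>carrier = a_rcosets\<^bsub>C\<^esub> (stalk_null R x C),
      mult = undefined, one = undefined,
      ring.zero = stalk_null R x C,
      add = set_add C,
      smult = (\<lambda>r \<zeta>. \<Union>{stalk_elt R x C (f \<odot>\<^bsub>C\<^esub> c) | f c.
                          f \<in> carrier R \<and> germ x f = r \<and> c \<in> \<zeta>})\<rparr>"

text \<open>The map of stalks induced by a linear map \<open>h\<close> into \<open>B\<close>.\<close>

definition stalk_map ::
  "('m::topological_space \<Rightarrow> complex, 'm \<Rightarrow> complex) module \<Rightarrow> 'm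
    \<Rightarrow> ('m \<Rightarrow> complex, 'b) module \<Rightarrow> ('a \<Rightarrow> 'b) \<Rightarrow> 'a set \<Rightarrow> 'b set"
  where "stalk_map R x B h \<zeta> = (\<Union>a\<in>\<zeta>. stalk_elt R x B (h a))"

text \<open>The canonical identification of \<open>(C \<otimes>\<^sub>R C)\<^sub>x\<close> with \<open>C\<^sub>x \<otimes> C\<^sub>x\<close>, which takes the class
  of \<open>c \<otimes> d\<close> to \<open>c\<^sub>x \<otimes> d\<^sub>x\<close>. The second tensor product is over the ring of germs, whose set of
  elements is \<open>S\<close>.\<close>

definition stalk_tensor ::
  "('m::topological_space \<Rightarrow> complex, 'm \<Rightarrow> complex) module \<Rightarrow> ('m \<Rightarrow> complex) set set \<Rightarrow> 'm
    \<Rightarrow> ('m \<Rightarrow> complex, 'c) module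
    \<Rightarrow> ('c \<times> 'c \<Rightarrow>\<^sub>0 int) set set \<Rightarrow> ('c set \<times> 'c set \<Rightarrow>\<^sub>0 int) set"
  where "stalk_tensor R S x C T =
     (\<Union>t\<in>T. tensor_map S (stalk R x C) (stalk R x C) (stalk_elt R x C) (stalk_elt R x C) t)"

definition stalk_comult ::
  "('m::topological_space \<Rightarrow> complex, 'm \<Rightarrow> complex) module \<Rightarrow> ('m \<Rightarrow> complex) set set \<Rightarrow> 'm
    \<Rightarrow> ('m \<Rightarrow> complex, 'c) module \<Rightarrow> ('c \<Rightarrow> ('c \<times> 'c \<Rightarrow>\<^sub>0 int) set)
    \<Rightarrow> 'c set \<Rightarrow> ('c set \<times> 'c set \<Rightarrow>\<^sub>0 int) set"
  where "stalk_comult R S x C \<Delta> \<zeta> =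
     stalk_tensor R S x C (stalk_map R x (tensor (carrier R) C C) \<Delta> \<zeta>)"

definition stalk_counit ::
  "'m::topological_space \<Rightarrow> ('c \<Rightarrow> 'm \<Rightarrow> complex) \<Rightarrow> 'c set \<Rightarrow> ('m \<Rightarrow> complex) set"
  where "stalk_counit x \<epsilon> \<zeta> = (\<Union>c\<in>\<zeta>. germ x (\<epsilon> c))"

definition stalk_grouplike ::
  "('m::topological_space \<Rightarrow> complex, 'm \<Rightarrow> complex) module \<Rightarrow> ('m \<Rightarrow> complex) set set \<Rightarrow> 'm
    \<Rightarrow> ('m \<Rightarrow> complex, 'c) module \<Rightarrow> ('c \<Rightarrow> ('c \<times> 'c \<Rightarrow>\<^sub>0 int) set)
    \<Rightarrow> ('c \<Rightarrow> 'm \<Rightarrow> complex) \<Rightarrow> 'c set set"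
  where "stalk_grouplike R S x C \<Delta> \<epsilon> =
     {\<zeta> \<in> carrier (stalk R x C).
        stalk_comult R S x C \<Delta> \<zeta> = pure_tensor S (stalk R x C) (stalk R x C) \<zeta> \<zeta> \<and>
        stalk_counit x \<epsilon> \<zeta> = germ x (\<lambda>_. 1)}"

end

theory Submission
  imports Defs
begin

text \<open>Everything rests on one fact: the canonical map from \<open>(C \<otimes> C)\<^sub>x\<close> to the tensor square of
  \<open>C\<^sub>x\<close> over the germs is injective, with inverse given by lifting classes in \<open>C\<^sub>x\<close> to
  representatives. Hence if \<open>c\<^sub>x\<close> is grouplike, then \<open>\<Delta>(c)\<close> and \<open>c \<otimes> c\<close> agree after
  multiplication by some \<open>h\<close> that is 1 near \<open>x\<close>, and \<open>\<Delta>(f c) = f c \<otimes> c\<close> for every bump function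
  \<open>f\<close> supported where \<open>h = 1\<close>. Conversely, if \<open>\<Delta>(c) = c \<otimes> c'\<close>, the counit law reads
  \<open>\<epsilon>(c) c' = c\<close>, so \<open>c'\<^sub>x = c\<^sub>x\<close> when \<open>\<epsilon>(c)\<close> is 1 near \<open>x\<close>. Finally, \<open>c\<^sub>x = d\<^sub>x\<close> means \<open>f c = f d\<close>
  for some \<open>f\<close> that is 1 near \<open>x\<close>, and then \<open>f\<close> is also 1 near all points close to \<open>x\<close>.\<close>

section \<open>Representatives of tensors\<close>

text \<open>Chosen representatives respect neither sums nor scalars, so lifting is not linear on the
  nose: it sends a defining relation of the tensor square of the stalk to a formal sum that only
  becomes null after multiplication by some function equal to 1 near \<open>x\<close>. The argument
  therefore runs on formal sums in the free abelian group, where maps of tensors become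
  \<open>tensor_push\<close> and equality of tensors becomes membership of a difference in
  \<open>tensor_null\<close>. A second obstacle is that \<open>R\<close> has a unit only if the
  manifold is compact. Functions with germ 1 at \<open>x\<close> replace it: products of two of them
  are again of this kind, and each acts as the identity on the stalk. Since \<Delta> is linear, a
  cut-off function multiplies one tensor factor alone; this is why the global counterpart of a
  grouplike class is an element that is weakly grouplike. The algebra is done for any ring of
  functions with enough bump functions. Smoothness enters in constructing these and in showing that
  every germ of a smooth function is the germ of an element of \<open>R\<close>.\<close>

definition tensor_push :: "('a \<Rightarrow> 'c) \<Rightarrow> ('b \<Rightarrow> 'd) \<Rightarrow> ('a \<times> 'b \<Rightarrow>\<^sub>0 int) \<Rightarrow> ('c \<times> 'd \<Rightarrow>\<^sub>0 int)"
  where "tensor_push f g = frag_extend (\<lambda>(a, b). frag_of (f a, g b))"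

lemma tensor_push_of [simp]: "tensor_push f g (frag_of (a, b)) = frag_of (f a, g b)"
  by (simp add: tensor_push_def)

lemma tensor_push_0 [simp]: "tensor_push f g 0 = 0"
  by (simp add: tensor_push_def)

lemma tensor_push_add: "tensor_push f g (u + v) = tensor_push f g u + tensor_push f g v"
  by (simp add: tensor_push_def frag_extend_add)

lemma tensor_push_diff: "tensor_push f g (u - v) = tensor_push f g u - tensor_push f g v"
  by (simp add: tensor_push_def frag_extend_diff)

lemma tensor_push_push:
  "tensor_push f g (tensor_push f' g' u) = tensor_push (f \<circ> f') (g \<circ> g') u"
  by (induction u rule: frag_induction[where S = UNIV, OF subset_UNIV])
    (auto simp: tensor_push_diff)

lemma tensor_push_cong:
  assumes "Poly_Mapping.keys u \<subseteq> X \<times> Y"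
    and "\<And>a. a \<in> X \<Longrightarrow> f a = f' a" "\<And>b. b \<in> Y \<Longrightarrow> g b = g' b"
  shows "tensor_push f g u = tensor_push f' g' u"
  unfolding tensor_push_def using assms by (intro frag_extend_eq) auto

lemma keys_diff_subset:
  assumes "Poly_Mapping.keys u \<subseteq> X" "Poly_Mapping.keys v \<subseteq> X"
  shows "Poly_Mapping.keys (u - v :: 'a \<Rightarrow>\<^sub>0 int) \<subseteq> X"
  using assms keys_diff[of u v] by blast

lemma keys_add_subset:
  assumes "Poly_Mapping.keys u \<subseteq> X" "Poly_Mapping.keys v \<subseteq> X"
  shows "Poly_Mapping.keys (u + v :: 'a \<Rightarrow>\<^sub>0 int) \<subseteq> X"
  using assms Poly_Mapping.keys_add[of u v] by blast

text \<open>Closure is enough to handle the tensor product as an abelian group given by generators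
  and relations. In this way stalks qualify as factors without first being shown to be modules over
  the germs.\<close>

locale tensor_factors =
  fixes S :: "'r set" and A :: "('r, 'a) module" and B :: "('r, 'b) module"
  assumes add_closed_left: "\<lbrakk>a \<in> carrier A; a' \<in> carrier A\<rbrakk> \<Longrightarrow> a \<oplus>\<^bsub>A\<^esub> a' \<in> carrier A"
    and add_closed_right: "\<lbrakk>b \<in> carrier B; b' \<in> carrier B\<rbrakk> \<Longrightarrow> b \<oplus>\<^bsub>B\<^esub> b' \<in> carrier B"
    and smult_closed_left: "\<lbrakk>r \<in> S; a \<in> carrier A\<rbrakk> \<Longrightarrow> r \<odot>\<^bsub>A\<^esub> a \<in> carrier A"
    and smult_closed_right: "\<lbrakk>r \<in> S; b \<in> carrier B\<rbrakk> \<Longrightarrow> r \<odot>\<^bsub>B\<^esub> b \<in> carrier B"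
begin

abbreviation "N \<equiv> tensor_null S A B"
abbreviation "AB \<equiv> carrier A \<times> carrier B"

lemma keys_tensor_relations:
  "u \<in> tensor_relations S A B \<Longrightarrow> Poly_Mapping.keys u \<subseteq> AB"
  unfolding tensor_relations_def
  by (elim UnE CollectE exE conjE; hypsubst; intro keys_diff_subset)
    (simp_all add: add_closed_left add_closed_right smult_closed_left smult_closed_right)

text \<open>Closure under differences, together with 0, covers inverses as 0 - h and sums as u - (0
  - v). The group inverse is negation only for formal sums with keys in \<open>AB\<close>, hence the
  appeal to the keys of the relations.\<close>

lemma tensor_null_induct [consumes 1, case_names rel zero diff]:
  assumes "u \<in> N"
    and "\<And>u. u \<in> tensor_relations S A B \<Longrightarrow> P u" and "P 0"
    and "\<And>u v. P u \<Longrightarrow> P v \<Longrightarrow> P (u - v)"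
  shows "P u"
  using assms(1) unfolding tensor_null_def
proof (induction rule: generate.induct)
  case one
  then show ?case using assms by (simp add: tensor_free_def)
next
  case (incl h)
  then show ?case using assms by simp
next
  case (inv h)
  then have "inv\<^bsub>tensor_free A B\<^esub> h = 0 - h"
    using keys_tensor_relations[OF inv] by (simp add: tensor_free_def)
  then show ?case using assms inv by metis
next
  case (eng u v)
  have "P (u - (0 - v))" using eng assms by blast
  then show ?case by (simp add: tensor_free_def)
qed

lemma keys_tensor_null: "u \<in> N \<Longrightarrow> Poly_Mapping.keys u \<subseteq> AB"
  by (induction rule: tensor_null_induct) (auto simp: keys_tensor_relations keys_diff_subset)

lemma tensor_null_rel: "u \<in> tensor_relations S A B \<Longrightarrow> u \<in> N"
  by (simp add: generate.incl tensor_null_def)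

lemma tensor_null_zero: "0 \<in> N"
  using generate.one[of "tensor_free A B"] by (simp add: tensor_null_def tensor_free_def)

lemma tensor_null_add: "u \<in> N \<Longrightarrow> v \<in> N \<Longrightarrow> u + v \<in> N"
  using generate.eng[of u "tensor_free A B"] by (simp add: tensor_null_def tensor_free_def)

text \<open>The rules of \<open>generate\<close> invert generators only; inverses of arbitrary
  elements come from the subgroup property.\<close>

lemma tensor_null_diff:
  assumes "u \<in> N" "v \<in> N" shows "u - v \<in> N"
proof -
  have "subgroup N (tensor_free A B)" unfolding tensor_null_def
    using keys_tensor_relations
    by (intro group.generate_is_subgroup) (auto simp: tensor_free_def)
  then have "inv\<^bsub>tensor_free A B\<^esub> v \<in> N" using assms by (simp add: subgroup.m_inv_closed)
  then have "- v \<in> N" using keys_tensor_null[OF assms(2)] by (simp add: tensor_free_def)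
  with tensor_null_add[OF assms(1) this] show ?thesis by simp
qed

lemma tensor_null_add_left:
  "\<lbrakk>a \<in> carrier A; a' \<in> carrier A; b \<in> carrier B\<rbrakk>
    \<Longrightarrow> frag_of (a \<oplus>\<^bsub>A\<^esub> a', b) - frag_of (a, b) - frag_of (a', b) \<in> N"
  by (rule tensor_null_rel) (auto simp: tensor_relations_def)

lemma tensor_null_add_right:
  "\<lbrakk>a \<in> carrier A; b \<in> carrier B; b' \<in> carrier B\<rbrakk>
    \<Longrightarrow> frag_of (a, b \<oplus>\<^bsub>B\<^esub> b') - frag_of (a, b) - frag_of (a, b') \<in> N"
  by (rule tensor_null_rel) (auto simp: tensor_relations_def)

lemma tensor_null_balanced:
  "\<lbrakk>r \<in> S; a \<in> carrier A; b \<in> carrier B\<rbrakk>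
    \<Longrightarrow> frag_of (r \<odot>\<^bsub>A\<^esub> a, b) - frag_of (a, r \<odot>\<^bsub>B\<^esub> b) \<in> N"
  by (rule tensor_null_rel) (auto simp: tensor_relations_def)

lemma tensor_class_eq: "tensor_class S A B u = {n + u | n. n \<in> N}"
  by (auto simp: tensor_class_def r_coset_def tensor_free_def)

lemma tensor_class_self: "u \<in> tensor_class S A B u"
  using tensor_null_zero by (force simp: tensor_class_eq)

lemma tensor_class_eq_iff:
  "tensor_class S A B u = tensor_class S A B v \<longleftrightarrow> u - v \<in> N" (is "?l = ?r \<longleftrightarrow> _")
proof
  assume "?l = ?r"
  then have "u \<in> ?r" using tensor_class_self by blast
  then show "u - v \<in> N" by (auto simp: tensor_class_eq)
next
  assume uv: "u - v \<in> N"
  have "n + u \<in> ?r" if "n \<in> N" for n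
    using tensor_null_add[OF that uv] by (auto simp: tensor_class_eq intro!: exI[of _ "n + (u - v)"])
  moreover have "n + v \<in> ?l" if "n \<in> N" for n
    using tensor_null_diff[OF that uv] by (auto simp: tensor_class_eq intro!: exI[of _ "n - (u - v)"])
  ultimately show "?l = ?r" by (auto simp: tensor_class_eq[of u] tensor_class_eq[of v])
qed

lemma carrier_tensor:
  "carrier (tensor S A B) = tensor_class S A B ` {u. Poly_Mapping.keys u \<subseteq> AB}"
  by (auto simp: tensor_def carrier_FactGroup tensor_class_def[abs_def] tensor_free_def)

lemma zero_tensor: "\<zero>\<^bsub>tensor S A B\<^esub> = tensor_class S A B 0"
  by (auto simp: tensor_def tensor_class_eq)

lemma add_tensor:
  "tensor_class S A B u \<oplus>\<^bsub>tensor S A B\<^esub> tensor_class S A B v = tensor_class S A B (u + v)"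
proof -
  have "tensor_class S A B u \<oplus>\<^bsub>tensor S A B\<^esub> tensor_class S A B v
      = {a + b | a b. a \<in> tensor_class S A B u \<and> b \<in> tensor_class S A B v}"
    by (auto simp: tensor_def set_mult_def tensor_free_def)
  also have "\<dots> = tensor_class S A B (u + v)"
  proof (intro equalityI subsetI)
    fix e assume "e \<in> {a + b | a b. a \<in> tensor_class S A B u \<and> b \<in> tensor_class S A B v}"
    then obtain m n where "m \<in> N" "n \<in> N" "e = (m + u) + (n + v)" by (auto simp: tensor_class_eq)
    then have "e = (m + n) + (u + v)" "m + n \<in> N"
      by (simp_all add: tensor_null_add algebra_simps)
    then show "e \<in> tensor_class S A B (u + v)" unfolding tensor_class_eq by blast
  next
    fix e assume "e \<in> tensor_class S A B (u + v)"
    then obtain n where "n \<in> N" "e = (n + u) + v" by (auto simp: tensor_class_eq add.assoc)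
    moreover have "v \<in> tensor_class S A B v" by (rule tensor_class_self)
    ultimately show "e \<in> {a + b | a b. a \<in> tensor_class S A B u \<and> b \<in> tensor_class S A B v}"
      unfolding tensor_class_eq[of u] by blast
  qed
  finally show ?thesis .
qed

end

text \<open>The scalar r' may live in another ring than r, but has to serve both factors. This
  covers linear maps over one ring (r' = r) as well as passage to the stalk, where r acts through
  its germ.\<close>

locale tensor_hom = T: tensor_factors S A B + T': tensor_factors S' A' B'
  for S :: "'r set" and A :: "('r, 'a) module" and B :: "('r, 'b) module"
    and S' :: "'s set" and A' :: "('s, 'c) module" and B' :: "('s, 'd) module" +
  fixes f :: "'a \<Rightarrow> 'c" and g :: "'b \<Rightarrow> 'd"
  assumes left_closed: "a \<in> carrier A \<Longrightarrow> f a \<in> carrier A'"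
    and right_closed: "b \<in> carrier B \<Longrightarrow> g b \<in> carrier B'"
    and left_add: "\<lbrakk>a \<in> carrier A; a' \<in> carrier A\<rbrakk> \<Longrightarrow> f (a \<oplus>\<^bsub>A\<^esub> a') = f a \<oplus>\<^bsub>A'\<^esub> f a'"
    and right_add: "\<lbrakk>b \<in> carrier B; b' \<in> carrier B\<rbrakk> \<Longrightarrow> g (b \<oplus>\<^bsub>B\<^esub> b') = g b \<oplus>\<^bsub>B'\<^esub> g b'"
    and balanced: "r \<in> S \<Longrightarrow> \<exists>r'\<in>S'. (\<forall>a\<in>carrier A. f (r \<odot>\<^bsub>A\<^esub> a) = r' \<odot>\<^bsub>A'\<^esub> f a) \<and>
          (\<forall>b\<in>carrier B. g (r \<odot>\<^bsub>B\<^esub> b) = r' \<odot>\<^bsub>B'\<^esub> g b)"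
begin

lemma tensor_push_null: "u \<in> T.N \<Longrightarrow> tensor_push f g u \<in> T'.N"
proof (induction rule: T.tensor_null_induct)
  case (rel u)
  then consider
      a a' b where "u = frag_of (a \<oplus>\<^bsub>A\<^esub> a', b) - frag_of (a, b) - frag_of (a', b)"
        "a \<in> carrier A" "a' \<in> carrier A" "b \<in> carrier B"
    | a b b' where "u = frag_of (a, b \<oplus>\<^bsub>B\<^esub> b') - frag_of (a, b) - frag_of (a, b')"
        "a \<in> carrier A" "b \<in> carrier B" "b' \<in> carrier B"
    | r a b where "u = frag_of (r \<odot>\<^bsub>A\<^esub> a, b) - frag_of (a, r \<odot>\<^bsub>B\<^esub> b)"
        "r \<in> S" "a \<in> carrier A" "b \<in> carrier B"
    unfolding tensor_relations_def by blast
  then show ?case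
  proof cases
    case 1
    then show ?thesis
      using T'.tensor_null_add_left[of "f a" "f a'" "g b"]
      by (simp add: tensor_push_diff left_add left_closed right_closed)
  next
    case 2
    then show ?thesis
      using T'.tensor_null_add_right[of "f a" "g b" "g b'"]
      by (simp add: tensor_push_diff right_add left_closed right_closed)
  next
    case 3
    then obtain r' where "r' \<in> S'" "f (r \<odot>\<^bsub>A\<^esub> a) = r' \<odot>\<^bsub>A'\<^esub> f a" "g (r \<odot>\<^bsub>B\<^esub> b) = r' \<odot>\<^bsub>B'\<^esub> g b"
      using balanced by blast
    with 3 show ?thesis
      using T'.tensor_null_balanced[of r' "f a" "g b"]
      by (simp add: tensor_push_diff left_closed right_closed)
  qed
qed (auto simp: T'.tensor_null_zero tensor_push_diff T'.tensor_null_diff)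

text \<open>\<open>tensor_map\<close> is a union over all representatives. Two representatives
  differ by a null sum, whose push is null again, so all members of the union are the same
  class.\<close>

lemma tensor_map_class:
  "tensor_map S' A' B' f g (tensor_class S A B u) = tensor_class S' A' B' (tensor_push f g u)"
proof -
  have "tensor_class S' A' B' (tensor_push f g v) = tensor_class S' A' B' (tensor_push f g u)"
    if "v \<in> tensor_class S A B u" for v
    using that tensor_push_null
    by (auto simp: T.tensor_class_eq T'.tensor_class_eq_iff tensor_push_add)
  then show ?thesis
    using T.tensor_class_self[of u] unfolding tensor_map_def tensor_push_def[symmetric] by blast
qed

end

section \<open>Evaluation of formal sums in an abelian group\<close>

context abelian_group
begin

definition frag_eval :: "('i \<Rightarrow> 'a) \<Rightarrow> ('i \<Rightarrow>\<^sub>0 int) \<Rightarrow> 'a"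
  where "frag_eval \<beta> u = (\<Oplus>i\<in>Poly_Mapping.keys u. [Poly_Mapping.lookup u i] \<cdot> \<beta> i)"

lemma add_pow_int_0: "[(0::int)] \<cdot> x = \<zero>"
  by (simp add: add_pow_def)

text \<open>Cancellation can make the keys of u + v a proper subset of the keys of u and v together.
  Summing over a common finite index set, with zero terms added, allows a termwise
  comparison.\<close>

lemma frag_eval_superset:
  assumes "finite I" "Poly_Mapping.keys u \<subseteq> I" "\<And>i. i \<in> I \<Longrightarrow> \<beta> i \<in> carrier G"
  shows "frag_eval \<beta> u = (\<Oplus>i\<in>I. [Poly_Mapping.lookup u i] \<cdot> \<beta> i)"
  unfolding frag_eval_def using assms
  by (intro add.finprod_mono_neutral_cong_left) (auto simp: not_in_keys_iff_lookup_eq_zero add_pow_int_0)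

lemma frag_eval_of [simp]: "\<beta> i \<in> carrier G \<Longrightarrow> frag_eval \<beta> (frag_of i) = \<beta> i"
  by (simp add: frag_eval_def)

lemma frag_eval_add:
  assumes "Poly_Mapping.keys u \<subseteq> X" "Poly_Mapping.keys v \<subseteq> X" "\<And>i. i \<in> X \<Longrightarrow> \<beta> i \<in> carrier G"
  shows "frag_eval \<beta> (u + v) = frag_eval \<beta> u \<oplus> frag_eval \<beta> v"
proof -
  let ?I = "Poly_Mapping.keys u \<union> Poly_Mapping.keys v"
  have *: "finite ?I" "\<And>i. i \<in> ?I \<Longrightarrow> \<beta> i \<in> carrier G" using assms by auto
  have eval: "frag_eval \<beta> w = (\<Oplus>i\<in>?I. [Poly_Mapping.lookup w i] \<cdot> \<beta> i)"
    if "Poly_Mapping.keys w \<subseteq> ?I" for w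
    using frag_eval_superset[OF *(1) that *(2)] by simp
  have "frag_eval \<beta> (u + v)
      = (\<Oplus>i\<in>?I. [Poly_Mapping.lookup u i] \<cdot> \<beta> i \<oplus> [Poly_Mapping.lookup v i] \<cdot> \<beta> i)"
    unfolding eval[of "u + v", OF Poly_Mapping.keys_add]
    using *(2) by (intro add.finprod_cong') (simp_all add: lookup_add add.int_pow_mult)
  also have "\<dots> = frag_eval \<beta> u \<oplus> frag_eval \<beta> v"
    unfolding eval[of u, OF Un_upper1] eval[of v, OF Un_upper2]
    using *(2) by (intro finsum_addf) simp_all
  finally show ?thesis .
qed

lemma frag_eval_diff_eq_zero:
  assumes "Poly_Mapping.keys u \<subseteq> X" "Poly_Mapping.keys v \<subseteq> X" "\<And>i. i \<in> X \<Longrightarrow> \<beta> i \<in> carrier G"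
    and "frag_eval \<beta> u = frag_eval \<beta> v"
  shows "frag_eval \<beta> (u - v) = \<zero>"
proof -
  have c: "frag_eval \<beta> w \<in> carrier G" if "Poly_Mapping.keys w \<subseteq> X" for w
    unfolding frag_eval_def using assms(3) that by (intro finsum_closed) auto
  have "frag_eval \<beta> u = frag_eval \<beta> (u - v) \<oplus> frag_eval \<beta> v"
    using frag_eval_add[OF keys_diff_subset[OF assms(1,2)] assms(2,3)] by simp
  with assms c[OF assms(2)] c[OF keys_diff_subset[OF assms(1,2)]] show ?thesis
    by (simp add: add.r_cancel_one)
qed

end

lemma germ_eq_iff: "germ x f = germ x g \<longleftrightarrow> (\<forall>\<^sub>F y in nhds x. f y = g y)"
proof
  assume "germ x f = germ x g"
  moreover have "f \<in> germ x f" by (simp add: germ_def)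
  ultimately show "\<forall>\<^sub>F y in nhds x. f y = g y" by (simp add: germ_def)
next
  assume fg: "\<forall>\<^sub>F y in nhds x. f y = g y"
  have "(\<forall>\<^sub>F y in nhds x. h y = f y) \<longleftrightarrow> (\<forall>\<^sub>F y in nhds x. h y = g y)" for h
    by (rule eventually_subst, use fg in eventually_elim) simp
  then show "germ x f = germ x g" by (auto simp: germ_def)
qed

section \<open>Stalks of coalgebras over rings of functions\<close>

text \<open>Isolates what the algebra needs from the smooth setting: pointwise operations and,
  through \<open>bump\<close>, functions that are 1 near a point with support in a prescribed
  neighbourhood.\<close>

locale function_coalgebra = coalgebra R C \<Delta> \<epsilon>
  for R :: "('m::topological_space \<Rightarrow> complex, 'm \<Rightarrow> complex) module"
    and C :: "('m \<Rightarrow> complex, 'c) module"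
    and \<Delta> :: "'c \<Rightarrow> ('c \<times> 'c \<Rightarrow>\<^sub>0 int) set" and \<epsilon> :: "'c \<Rightarrow> 'm \<Rightarrow> complex" +
  assumes add_R [simp]: "f \<oplus>\<^bsub>R\<^esub> g = (\<lambda>y. f y + g y)"
    and mult_R [simp]: "f \<otimes>\<^bsub>R\<^esub> g = (\<lambda>y. f y * g y)"
    and smult_R [simp]: "f \<odot>\<^bsub>R\<^esub> g = (\<lambda>y. f y * g y)"
    and add_closed: "\<lbrakk>f \<in> carrier R; g \<in> carrier R\<rbrakk> \<Longrightarrow> (\<lambda>y. f y + g y) \<in> carrier R"
    and mult_closed: "\<lbrakk>f \<in> carrier R; g \<in> carrier R\<rbrakk> \<Longrightarrow> (\<lambda>y. f y * g y) \<in> carrier R"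
    and bump: "\<lbrakk>open U; x \<in> U\<rbrakk> \<Longrightarrow>
          \<exists>f\<in>carrier R. germ x f = germ x (\<lambda>_. 1) \<and> closure {y. f y \<noteq> 0} \<subseteq> U"
begin

section \<open>Functions that are 1 near a point\<close>

definition unit_at :: "'m \<Rightarrow> ('m \<Rightarrow> complex) \<Rightarrow> bool"
  where "unit_at x f \<longleftrightarrow> f \<in> carrier R \<and> germ x f = germ x (\<lambda>_. 1)"

abbreviation stalk_of :: "'m \<Rightarrow> 'c \<Rightarrow> 'c set"
  where "stalk_of x \<equiv> stalk_elt R x C"

abbreviation germs :: "'m \<Rightarrow> ('m \<Rightarrow> complex) set set"
  where "germs x \<equiv> germ x ` carrier R"

definition scale :: "('m \<Rightarrow> complex) \<Rightarrow> ('c \<times> 'c \<Rightarrow>\<^sub>0 int) \<Rightarrow> ('c \<times> 'c \<Rightarrow>\<^sub>0 int)"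
  where "scale f = tensor_push (\<lambda>a. f \<odot>\<^bsub>C\<^esub> a) (\<lambda>b. b)"

lemma unit_at_closed: "unit_at x f \<Longrightarrow> f \<in> carrier R"
  by (simp add: unit_at_def)

lemma unit_at_mult: "unit_at x f \<Longrightarrow> unit_at x g \<Longrightarrow> unit_at x (\<lambda>y. f y * g y)"
  unfolding unit_at_def germ_eq_iff using mult_closed by (auto elim: eventually_elim2)

text \<open>Replaces restriction to a neighbourhood. Multiplication by f turns an identity of
  functions that holds near x into one that holds everywhere, since f vanishes wherever the identity
  could fail.\<close>

lemma absorbing_unit_at:
  assumes "\<forall>\<^sub>F y in nhds x. P y"
  obtains f where "unit_at x f" "closure {y. f y \<noteq> 0} \<subseteq> {y. P y}" "\<forall>y. f y \<noteq> 0 \<longrightarrow> P y"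
proof -
  obtain U where U: "open U" "x \<in> U" "U \<subseteq> {y. P y}" using assms by (auto simp: eventually_nhds)
  obtain f where f: "unit_at x f" "closure {y. f y \<noteq> 0} \<subseteq> U"
    using bump[OF U(1,2)] unfolding unit_at_def by blast
  have "closure {y. f y \<noteq> 0} \<subseteq> {y. P y}" using f(2) U(3) by (rule order_trans)
  moreover from this closure_subset have "{y. f y \<noteq> 0} \<subseteq> {y. P y}" by (rule order_trans[rotated])
  ultimately show ?thesis using that[OF f(1)] by blast
qed

lemma unit_at_exists: obtains f where "unit_at x f"
  using absorbing_unit_at[OF always_eventually[of "\<lambda>_. True"]] by blast

lemma smult_mult:
  "\<lbrakk>f \<in> carrier R; g \<in> carrier R; c \<in> carrier C\<rbrakk> \<Longrightarrow> (\<lambda>y. f y * g y) \<odot>\<^bsub>C\<^esub> c = f \<odot>\<^bsub>C\<^esub> (g \<odot>\<^bsub>C\<^esub> c)"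
  using smult_assoc[of f g c] by simp

lemma smult_commute:
  "\<lbrakk>f \<in> carrier R; g \<in> carrier R; c \<in> carrier C\<rbrakk> \<Longrightarrow> f \<odot>\<^bsub>C\<^esub> (g \<odot>\<^bsub>C\<^esub> c) = g \<odot>\<^bsub>C\<^esub> (f \<odot>\<^bsub>C\<^esub> c)"
  using smult_mult[of f g c] smult_mult[of g f c] by (simp add: mult.commute)

text \<open>With h supported where f and g agree, hf = hg holds in \<open>R\<close> itself. This is
  what makes the action of a germ independent of the function that represents it.\<close>

lemma smult_eq_smult_if_germ_eq:
  assumes "f \<in> carrier R" "g \<in> carrier R" "germ x f = germ x g"
  obtains h where "unit_at x h"
    "\<And>c. c \<in> carrier C \<Longrightarrow> h \<odot>\<^bsub>C\<^esub> (f \<odot>\<^bsub>C\<^esub> c) = h \<odot>\<^bsub>C\<^esub> (g \<odot>\<^bsub>C\<^esub> c)"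
proof -
  obtain h where h: "unit_at x h" "closure {y. h y \<noteq> 0} \<subseteq> {y. f y = g y}"
      "\<forall>y. h y \<noteq> 0 \<longrightarrow> f y = g y"
    using absorbing_unit_at[OF assms(3)[unfolded germ_eq_iff]] .
  have "(\<lambda>y. h y * f y) = (\<lambda>y. h y * g y)"
  proof
    fix y show "h y * f y = h y * g y" by (cases "h y = 0") (simp_all add: h(3))
  qed
  then have "h \<odot>\<^bsub>C\<^esub> (f \<odot>\<^bsub>C\<^esub> c) = h \<odot>\<^bsub>C\<^esub> (g \<odot>\<^bsub>C\<^esub> c)" if "c \<in> carrier C" for c
    using smult_mult[of h f c] smult_mult[of h g c] assms unit_at_closed[OF h(1)] that by simp
  with that h(1) show ?thesis by blast
qed

text \<open>Translates the condition defining \<open>stalk_null\<close> for a difference into fc =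
  fd, a form that avoids inverses.\<close>

lemma smult_minus_eq_zero_iff:
  assumes f: "f \<in> carrier R" and c: "c \<in> carrier C" "d \<in> carrier C"
  shows "f \<odot>\<^bsub>C\<^esub> (c \<ominus>\<^bsub>C\<^esub> d) = \<zero>\<^bsub>C\<^esub> \<longleftrightarrow> f \<odot>\<^bsub>C\<^esub> c = f \<odot>\<^bsub>C\<^esub> d"
proof -
  have "(c \<ominus>\<^bsub>C\<^esub> d) \<oplus>\<^bsub>C\<^esub> d = c" using c by (simp add: a_minus_def a_assoc l_neg)
  then have "f \<odot>\<^bsub>C\<^esub> c = f \<odot>\<^bsub>C\<^esub> (c \<ominus>\<^bsub>C\<^esub> d) \<oplus>\<^bsub>C\<^esub> f \<odot>\<^bsub>C\<^esub> d"
    using smult_r_distr[of f "c \<ominus>\<^bsub>C\<^esub> d" d] f c by simp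
  then show ?thesis using f c smult_closed add.r_cancel_one[of "f \<odot>\<^bsub>C\<^esub> d" "f \<odot>\<^bsub>C\<^esub> (c \<ominus>\<^bsub>C\<^esub> d)"]
    by simp
qed

text \<open>Describes the coset as the class of an equivalence relation: equality after
  multiplication by some function that is 1 near x.\<close>

lemma mem_stalk_elt:
  assumes c: "c \<in> carrier C"
  shows "d \<in> stalk_of x c \<longleftrightarrow> d \<in> carrier C \<and> (\<exists>f. unit_at x f \<and> f \<odot>\<^bsub>C\<^esub> d = f \<odot>\<^bsub>C\<^esub> c)"
proof
  assume "d \<in> stalk_of x c"
  then obtain n f where nf: "n \<in> carrier C" "d = n \<oplus>\<^bsub>C\<^esub> c" "unit_at x f" "f \<odot>\<^bsub>C\<^esub> n = \<zero>\<^bsub>C\<^esub>"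
    by (auto simp: stalk_elt_def a_r_coset_def' stalk_null_def unit_at_def)
  with c have "f \<odot>\<^bsub>C\<^esub> d = f \<odot>\<^bsub>C\<^esub> c"
    using smult_r_distr[of f n c] smult_closed[of f c] by (simp add: unit_at_closed)
  with nf c show "d \<in> carrier C \<and> (\<exists>f. unit_at x f \<and> f \<odot>\<^bsub>C\<^esub> d = f \<odot>\<^bsub>C\<^esub> c)" by auto
next
  assume "d \<in> carrier C \<and> (\<exists>f. unit_at x f \<and> f \<odot>\<^bsub>C\<^esub> d = f \<odot>\<^bsub>C\<^esub> c)"
  then obtain f where d: "d \<in> carrier C" and f: "unit_at x f" "f \<odot>\<^bsub>C\<^esub> d = f \<odot>\<^bsub>C\<^esub> c" by blast
  have "f \<odot>\<^bsub>C\<^esub> (d \<ominus>\<^bsub>C\<^esub> c) = \<zero>\<^bsub>C\<^esub>" using f d c smult_minus_eq_zero_iff[of f d c] by (simp add: unit_at_closed)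
  moreover have "(d \<ominus>\<^bsub>C\<^esub> c) \<oplus>\<^bsub>C\<^esub> c = d" using c d by (simp add: a_minus_def a_assoc l_neg)
  ultimately show "d \<in> stalk_of x c"
    using f d c unfolding stalk_elt_def a_r_coset_def' stalk_null_def unit_at_def
    by (intro UN_I[of "d \<ominus>\<^bsub>C\<^esub> c"]) auto
qed

lemma stalk_elt_self: "c \<in> carrier C \<Longrightarrow> c \<in> stalk_of x c"
  using unit_at_exists[of x] by (auto simp: mem_stalk_elt)

lemma stalk_elt_eq_iff:
  assumes c: "c \<in> carrier C" and d: "d \<in> carrier C"
  shows "stalk_of x c = stalk_of x d \<longleftrightarrow> (\<exists>f. unit_at x f \<and> f \<odot>\<^bsub>C\<^esub> c = f \<odot>\<^bsub>C\<^esub> d)"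
proof
  assume "stalk_of x c = stalk_of x d"
  then have "c \<in> stalk_of x d" using stalk_elt_self[OF c] by blast
  then show "\<exists>f. unit_at x f \<and> f \<odot>\<^bsub>C\<^esub> c = f \<odot>\<^bsub>C\<^esub> d" using d mem_stalk_elt by simp
next
  assume "\<exists>f. unit_at x f \<and> f \<odot>\<^bsub>C\<^esub> c = f \<odot>\<^bsub>C\<^esub> d"
  then obtain f where f: "unit_at x f" "f \<odot>\<^bsub>C\<^esub> c = f \<odot>\<^bsub>C\<^esub> d" by blast
  \<comment> \<open>Transitivity of the relation: if f identifies c' with d' and g identifies e with
    c', the product fg identifies e with d', because scalars commute.\<close>
  have sub: "stalk_of x c' \<subseteq> stalk_of x d'"
    if eq: "f \<odot>\<^bsub>C\<^esub> c' = f \<odot>\<^bsub>C\<^esub> d'" and c': "c' \<in> carrier C" and d': "d' \<in> carrier C" for c' d'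
  proof
    fix e assume "e \<in> stalk_of x c'"
    then obtain g where g: "unit_at x g" "g \<odot>\<^bsub>C\<^esub> e = g \<odot>\<^bsub>C\<^esub> c'" and e: "e \<in> carrier C"
      unfolding mem_stalk_elt[OF c'] by blast
    note fR = unit_at_closed[OF f(1)] and gR = unit_at_closed[OF g(1)]
    have "(\<lambda>y. f y * g y) \<odot>\<^bsub>C\<^esub> e = f \<odot>\<^bsub>C\<^esub> (g \<odot>\<^bsub>C\<^esub> c')"
      by (simp only: smult_mult[OF fR gR e] g(2))
    also have "\<dots> = g \<odot>\<^bsub>C\<^esub> (f \<odot>\<^bsub>C\<^esub> d')" by (simp only: smult_commute[OF fR gR c'] eq)
    also have "\<dots> = (\<lambda>y. f y * g y) \<odot>\<^bsub>C\<^esub> d'"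
      by (simp only: smult_mult[OF fR gR d'] smult_commute[OF gR fR d'])
    finally show "e \<in> stalk_of x d'"
      unfolding mem_stalk_elt[OF d'] using e unit_at_mult[OF f(1) g(1)] by blast
  qed
  show "stalk_of x c = stalk_of x d"
    using sub[OF f(2) c d] sub[OF f(2)[symmetric] d c] by blast
qed

text \<open>There may be no constant 1 in \<open>R\<close> to compare f with. Instead g is chosen
  with support where f = 1, so that gf = g.\<close>

lemma stalk_elt_smult_unit:
  assumes "unit_at x f" "c \<in> carrier C"
  shows "stalk_of x (f \<odot>\<^bsub>C\<^esub> c) = stalk_of x c"
proof -
  have f: "f \<in> carrier R" using assms unit_at_closed by blast
  have near: "\<forall>\<^sub>F y in nhds x. f y = 1" using assms(1) by (simp add: unit_at_def germ_eq_iff)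
  obtain g where g: "unit_at x g" "closure {y. g y \<noteq> 0} \<subseteq> {y. f y = 1}"
      "\<forall>y. g y \<noteq> 0 \<longrightarrow> f y = 1"
    using absorbing_unit_at[OF near] .
  have "(\<lambda>y. g y * f y) = g"
  proof
    fix y show "g y * f y = g y" by (cases "g y = 0") (simp_all add: g(3))
  qed
  then have "g \<odot>\<^bsub>C\<^esub> (f \<odot>\<^bsub>C\<^esub> c) = g \<odot>\<^bsub>C\<^esub> c"
    using smult_mult[OF unit_at_closed[OF g(1)] f assms(2)] by simp
  with g(1) show ?thesis using stalk_elt_eq_iff[OF smult_closed[OF f assms(2)] assms(2)] by blast
qed

section \<open>Module operations on the stalk\<close>

lemma carrier_stalk: "carrier (stalk R x C) = stalk_of x ` carrier C"
  by (auto simp: stalk_def A_RCOSETS_def' stalk_elt_def)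

text \<open>A sum of representatives lies in the class of the sum because the product of the two
  witnesses works for both summands. Conversely, e in the class of c + d is split as (e - d) + d,
  and the witness for e also shows that e - d is in the class of c.\<close>

lemma add_stalk:
  assumes c: "c \<in> carrier C" and d: "d \<in> carrier C"
  shows "stalk_of x c \<oplus>\<^bsub>stalk R x C\<^esub> stalk_of x d = stalk_of x (c \<oplus>\<^bsub>C\<^esub> d)"
proof -
  have "stalk_of x c \<oplus>\<^bsub>stalk R x C\<^esub> stalk_of x d
      = {a \<oplus>\<^bsub>C\<^esub> b | a b. a \<in> stalk_of x c \<and> b \<in> stalk_of x d}"
    by (auto simp: stalk_def set_add_defs)
  also have "\<dots> = stalk_of x (c \<oplus>\<^bsub>C\<^esub> d)"
  proof (intro equalityI subsetI)
    fix e assume "e \<in> {a \<oplus>\<^bsub>C\<^esub> b | a b. a \<in> stalk_of x c \<and> b \<in> stalk_of x d}"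
    then obtain a b where e: "e = a \<oplus>\<^bsub>C\<^esub> b" "a \<in> stalk_of x c" "b \<in> stalk_of x d" by blast
    then obtain f g where fg: "unit_at x f" "f \<odot>\<^bsub>C\<^esub> a = f \<odot>\<^bsub>C\<^esub> c" "unit_at x g" "g \<odot>\<^bsub>C\<^esub> b = g \<odot>\<^bsub>C\<^esub> d"
      and ab: "a \<in> carrier C" "b \<in> carrier C"
      using c d by (auto simp: mem_stalk_elt)
    note fgR = unit_at_closed[OF fg(1)] unit_at_closed[OF fg(3)]
    let ?h = "\<lambda>y. f y * g y"
    have h: "unit_at x ?h" using fg unit_at_mult by blast
    have "?h \<odot>\<^bsub>C\<^esub> a = ?h \<odot>\<^bsub>C\<^esub> c" "?h \<odot>\<^bsub>C\<^esub> b = ?h \<odot>\<^bsub>C\<^esub> d"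
      using fg fgR ab c d smult_commute[of f g a] smult_commute[of f g c]
      by (simp_all add: smult_mult)
    then have "?h \<odot>\<^bsub>C\<^esub> e = ?h \<odot>\<^bsub>C\<^esub> (c \<oplus>\<^bsub>C\<^esub> d)"
      using unit_at_closed[OF h] ab c d e(1) by (simp add: smult_r_distr)
    with h ab c d e(1) show "e \<in> stalk_of x (c \<oplus>\<^bsub>C\<^esub> d)" by (auto simp: mem_stalk_elt)
  next
    fix e assume e: "e \<in> stalk_of x (c \<oplus>\<^bsub>C\<^esub> d)"
    then obtain f where f: "unit_at x f" "f \<odot>\<^bsub>C\<^esub> e = f \<odot>\<^bsub>C\<^esub> (c \<oplus>\<^bsub>C\<^esub> d)" and eC: "e \<in> carrier C"
      using c d by (auto simp: mem_stalk_elt)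
    have ed: "(e \<ominus>\<^bsub>C\<^esub> d) \<oplus>\<^bsub>C\<^esub> d = e"
      using eC c d by (simp add: a_minus_def a_assoc l_neg)
    moreover have "(e \<ominus>\<^bsub>C\<^esub> d) \<ominus>\<^bsub>C\<^esub> c = e \<ominus>\<^bsub>C\<^esub> (c \<oplus>\<^bsub>C\<^esub> d)"
      using eC c d by (simp add: a_minus_def a_assoc minus_add a_comm a_lcomm)
    ultimately have "f \<odot>\<^bsub>C\<^esub> (e \<ominus>\<^bsub>C\<^esub> d) = f \<odot>\<^bsub>C\<^esub> c"
      using smult_minus_eq_zero_iff[of f "e \<ominus>\<^bsub>C\<^esub> d" c] smult_minus_eq_zero_iff[of f e "c \<oplus>\<^bsub>C\<^esub> d"] f eC c d
      by (simp add: unit_at_closed)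
    then have "e \<ominus>\<^bsub>C\<^esub> d \<in> stalk_of x c" using f eC c d by (auto simp: mem_stalk_elt)
    with ed stalk_elt_self[OF d, of x]
    show "e \<in> {a \<oplus>\<^bsub>C\<^esub> b | a b. a \<in> stalk_of x c \<and> b \<in> stalk_of x d}" by force
  qed
  finally show ?thesis .
qed

text \<open>Two independent choices have to be removed: the representative d of the class, through
  k, and the function g representing the germ, through h. Changing them one at a time needs no
  common witness.\<close>

lemma smult_stalk:
  assumes f: "f \<in> carrier R" and c: "c \<in> carrier C"
  shows "germ x f \<odot>\<^bsub>stalk R x C\<^esub> stalk_of x c = stalk_of x (f \<odot>\<^bsub>C\<^esub> c)"
proof -
  have "stalk_of x (g \<odot>\<^bsub>C\<^esub> d) = stalk_of x (f \<odot>\<^bsub>C\<^esub> c)"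
    if g: "g \<in> carrier R" "germ x g = germ x f" and d: "d \<in> stalk_of x c" for g d
  proof -
    obtain k where k: "unit_at x k" "k \<odot>\<^bsub>C\<^esub> d = k \<odot>\<^bsub>C\<^esub> c" and dC: "d \<in> carrier C"
      using d c by (auto simp: mem_stalk_elt)
    obtain h where h: "unit_at x h"
        "\<And>e. e \<in> carrier C \<Longrightarrow> h \<odot>\<^bsub>C\<^esub> (g \<odot>\<^bsub>C\<^esub> e) = h \<odot>\<^bsub>C\<^esub> (f \<odot>\<^bsub>C\<^esub> e)"
      using smult_eq_smult_if_germ_eq[OF g(1) f g(2)] by blast
    note hk = unit_at_closed[OF h(1)] unit_at_closed[OF k(1)]
    have "k \<odot>\<^bsub>C\<^esub> (g \<odot>\<^bsub>C\<^esub> d) = k \<odot>\<^bsub>C\<^esub> (g \<odot>\<^bsub>C\<^esub> c)" 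
      using k hk g dC c smult_commute[of k g d] smult_commute[of k g c] by simp
    then have "stalk_of x (g \<odot>\<^bsub>C\<^esub> d) = stalk_of x (g \<odot>\<^bsub>C\<^esub> c)"
      using k(1) stalk_elt_eq_iff[OF smult_closed[OF g(1) dC] smult_closed[OF g(1) c]] by blast
    also have "\<dots> = stalk_of x (f \<odot>\<^bsub>C\<^esub> c)"
      using h(1) h(2)[OF c] stalk_elt_eq_iff[OF smult_closed[OF g(1) c] smult_closed[OF f c]]
      by blast
    finally show ?thesis .
  qed
  moreover have "\<exists>g d. g \<in> carrier R \<and> germ x g = germ x f \<and> d \<in> stalk_of x c"
    using f c stalk_elt_self by blast
  ultimately have "{stalk_elt R x C (g \<odot>\<^bsub>C\<^esub> d) | g d. g \<in> carrier R \<and> germ x g = germ x f \<and> d \<in> stalk_of x c}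
      = {stalk_of x (f \<odot>\<^bsub>C\<^esub> c)}" by blast
  then show ?thesis by (simp add: stalk_def)
qed

section \<open>Tensor squares of the coalgebra and of its stalks\<close>

sublocale CC: tensor_factors "carrier R" C C
  by unfold_locales (auto simp: smult_closed)

sublocale RC: tensor_factors "carrier R" R C
  by unfold_locales (auto simp: smult_closed add_closed mult_closed)

lemma stalk_factors: "tensor_factors (germs x) (stalk R x C) (stalk R x C)"
  by unfold_locales (auto simp: carrier_stalk add_stalk smult_stalk smult_closed)

text \<open>Acting on the left factor alone is balanced because scalars commute: f(ra) = r(fa), so
  r' = r.\<close>

lemma scale_hom:
  assumes "f \<in> carrier R"
  shows "tensor_hom (carrier R) C C (carrier R) C C (\<lambda>a. f \<odot>\<^bsub>C\<^esub> a) (\<lambda>b. b)"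
  by unfold_locales (use assms smult_commute[of f] in \<open>auto simp: smult_closed smult_r_distr\<close>)

text \<open>The scalar that matches r is its germ at x.\<close>

lemma stalk_hom:
  "tensor_hom (carrier R) C C (germs x) (stalk R x C) (stalk R x C) (stalk_of x) (stalk_of x)"
proof -
  interpret S: tensor_factors "germs x" "stalk R x C" "stalk R x C" by (rule stalk_factors)
  show ?thesis
    by unfold_locales (auto simp: carrier_stalk add_stalk smult_stalk)
qed

lemma counit_hom: "tensor_hom (carrier R) C C (carrier R) R C \<epsilon> (\<lambda>b. b)"
  using counit_linear by unfold_locales (auto simp: module_linear_def)

lemma smult_tensor:
  "f \<in> carrier R \<Longrightarrow> f \<odot>\<^bsub>tensor (carrier R) C C\<^esub> tensor_class (carrier R) C C u
    = tensor_class (carrier R) C C (scale f u)"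
  using tensor_hom.tensor_map_class[OF scale_hom] by (simp add: tensor_def scale_def)

lemma comult_class:
  assumes "c \<in> carrier C"
  obtains u where "Poly_Mapping.keys u \<subseteq> carrier C \<times> carrier C" "\<Delta> c = tensor_class (carrier R) C C u"
  using comult_linear assms by (fastforce simp: module_linear_def CC.carrier_tensor)

lemma comult_smult:
  assumes "f \<in> carrier R" "c \<in> carrier C" "\<Delta> c = tensor_class (carrier R) C C u"
  shows "\<Delta> (f \<odot>\<^bsub>C\<^esub> c) = tensor_class (carrier R) C C (scale f u)"
  using comult_linear assms by (simp add: module_linear_def smult_tensor)

lemma counit_smult:
  "f \<in> carrier R \<Longrightarrow> c \<in> carrier C \<Longrightarrow> \<epsilon> (f \<odot>\<^bsub>C\<^esub> c) = (\<lambda>y. f y * \<epsilon> c y)"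
  using counit_linear by (simp add: module_linear_def)

lemma counit_closed: "c \<in> carrier C \<Longrightarrow> \<epsilon> c \<in> carrier R"
  using counit_linear by (simp add: module_linear_def)

lemma scale_null: "f \<in> carrier R \<Longrightarrow> u \<in> CC.N \<Longrightarrow> scale f u \<in> CC.N"
  unfolding scale_def by (rule tensor_hom.tensor_push_null[OF scale_hom])

lemma scale_scale:
  assumes "f \<in> carrier R" "g \<in> carrier R" "Poly_Mapping.keys u \<subseteq> carrier C \<times> carrier C"
  shows "scale (\<lambda>y. f y * g y) u = scale f (scale g u)"
  unfolding scale_def tensor_push_push using assms
  by (intro tensor_push_cong[OF assms(3)]) (auto simp: smult_mult)

lemma tensor_push_stalk_scale:
  assumes "unit_at x f" "Poly_Mapping.keys u \<subseteq> carrier C \<times> carrier C"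
  shows "tensor_push (stalk_of x) (stalk_of x) (scale f u) = tensor_push (stalk_of x) (stalk_of x) u"
  unfolding scale_def tensor_push_push using assms
  by (intro tensor_push_cong[OF assms(2)]) (auto simp: stalk_elt_smult_unit)

text \<open>Well-definedness of the canonical map on the stalk of C \<otimes> C: the factor f
  disappears on passing to classes, so what f annihilates is sent to 0.\<close>

lemma stalk_tensor_null_if_scale_null:
  assumes "unit_at x f" "Poly_Mapping.keys u \<subseteq> carrier C \<times> carrier C" "scale f u \<in> CC.N"
  shows "tensor_push (stalk_of x) (stalk_of x) u \<in> tensor_null (germs x) (stalk R x C) (stalk R x C)"
  using tensor_hom.tensor_push_null[OF stalk_hom assms(3), of x] assms
  by (simp add: tensor_push_stalk_scale)

text \<open>The kernel of the projection from the free abelian group on pairs to the stalk at x of C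
  \<otimes> C.\<close>

definition locally_null :: "'m \<Rightarrow> ('c \<times> 'c \<Rightarrow>\<^sub>0 int) set"
  where "locally_null x = {u. Poly_Mapping.keys u \<subseteq> carrier C \<times> carrier C \<and>
     (\<exists>f. unit_at x f \<and> scale f u \<in> CC.N)}"

lemma locally_null_diff:
  assumes "u \<in> locally_null x" "v \<in> locally_null x"
  shows "u - v \<in> locally_null x"
proof -
  obtain f g where fg: "unit_at x f" "scale f u \<in> CC.N" "unit_at x g" "scale g v \<in> CC.N"
    and keys: "Poly_Mapping.keys u \<subseteq> carrier C \<times> carrier C"
      "Poly_Mapping.keys v \<subseteq> carrier C \<times> carrier C"
    using assms by (auto simp: locally_null_def)
  note fgR = unit_at_closed[OF fg(1)] unit_at_closed[OF fg(3)]
  have "scale (\<lambda>y. g y * f y) (u - v) = scale g (scale f u) - scale f (scale g v)"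
    using scale_scale[OF fgR(2,1) keys(1)] scale_scale[OF fgR keys(2)]
    by (simp add: scale_def tensor_push_diff mult.commute)
  also have "\<dots> \<in> CC.N"
    by (rule CC.tensor_null_diff[OF scale_null[OF fgR(2) fg(2)] scale_null[OF fgR(1) fg(4)]])
  finally show ?thesis
    using unit_at_mult[OF fg(3,1)] keys_diff_subset[OF keys] unfolding locally_null_def by blast
qed

lemma locally_null_if_null:
  assumes "u \<in> CC.N" shows "u \<in> locally_null x"
proof -
  obtain f where f: "unit_at x f" using unit_at_exists .
  with scale_null[OF unit_at_closed[OF f] assms] CC.keys_tensor_null[OF assms] show ?thesis
    unfolding locally_null_def by blast
qed

lemma locally_null_zero: "0 \<in> locally_null x"
  by (rule locally_null_if_null[OF CC.tensor_null_zero])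

lemma locally_null_add:
  assumes "u \<in> locally_null x" "v \<in> locally_null x"
  shows "u + v \<in> locally_null x"
  using locally_null_diff[OF assms(1) locally_null_diff[OF locally_null_zero assms(2)]] by simp

text \<open>Balancedness lets each witness act on its own factor: gf(a \<otimes> b) = fa \<otimes>
  gb = fa' \<otimes> gb' = gf(a' \<otimes> b'). Hence the choice of representatives does not matter
  up to \<open>locally_null\<close>.\<close>

lemma locally_null_cong:
  assumes C: "a \<in> carrier C" "a' \<in> carrier C" "b \<in> carrier C" "b' \<in> carrier C"
    and eq: "stalk_of x a = stalk_of x a'" "stalk_of x b = stalk_of x b'"
  shows "frag_of (a, b) - frag_of (a', b') \<in> locally_null x"
proof -
  obtain f where f: "unit_at x f" "f \<odot>\<^bsub>C\<^esub> a = f \<odot>\<^bsub>C\<^esub> a'"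
    using eq(1) unfolding stalk_elt_eq_iff[OF C(1,2)] by blast
  obtain g where g: "unit_at x g" "g \<odot>\<^bsub>C\<^esub> b = g \<odot>\<^bsub>C\<^esub> b'"
    using eq(2) unfolding stalk_elt_eq_iff[OF C(3,4)] by blast
  note fR = unit_at_closed[OF f(1)] and gR = unit_at_closed[OF g(1)]
  have "frag_of (g \<odot>\<^bsub>C\<^esub> (f \<odot>\<^bsub>C\<^esub> a), b) - frag_of (f \<odot>\<^bsub>C\<^esub> a, g \<odot>\<^bsub>C\<^esub> b) \<in> CC.N"
    "frag_of (g \<odot>\<^bsub>C\<^esub> (f \<odot>\<^bsub>C\<^esub> a'), b') - frag_of (f \<odot>\<^bsub>C\<^esub> a', g \<odot>\<^bsub>C\<^esub> b') \<in> CC.N"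
    by (intro CC.tensor_null_balanced smult_closed fR gR C)+
  from CC.tensor_null_diff[OF this]
  have "scale (\<lambda>y. g y * f y) (frag_of (a, b) - frag_of (a', b')) \<in> CC.N"
    by (simp add: scale_def tensor_push_diff smult_mult[OF gR fR] C f(2) g(2))
  moreover have "Poly_Mapping.keys (frag_of (a, b) - frag_of (a', b') :: _ \<Rightarrow>\<^sub>0 int)
      \<subseteq> carrier C \<times> carrier C"
    using C by (intro keys_diff_subset) simp_all
  ultimately show ?thesis
    using unit_at_mult[OF g(1) f(1)] unfolding locally_null_def by blast
qed

text \<open>An arbitrary section of the projection to the stalk. It need not be additive or linear;
  \<open>locally_null_cong\<close> absorbs the error.\<close>

definition representative :: "'m \<Rightarrow> 'c set \<Rightarrow> 'c"
  where "representative x \<zeta> = (SOME c. c \<in> carrier C \<and> stalk_of x c = \<zeta>)"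

lemma representative:
  assumes "\<zeta> \<in> carrier (stalk R x C)"
  shows "representative x \<zeta> \<in> carrier C" "stalk_of x (representative x \<zeta>) = \<zeta>"
proof -
  have "\<exists>c. c \<in> carrier C \<and> stalk_of x c = \<zeta>" using assms by (auto simp: carrier_stalk)
  from someI_ex[OF this]
  show "representative x \<zeta> \<in> carrier C" "stalk_of x (representative x \<zeta>) = \<zeta>"
    unfolding representative_def by auto
qed

text \<open>Lifting is well defined up to local nullity. Each relation between classes lifts to the
  corresponding relation between representatives, except that the representative of a sum or
  multiple has to be exchanged for the sum or multiple of representatives; both lie in the same
  class.\<close>

lemma representative_null:
  assumes "w \<in> tensor_null (germs x) (stalk R x C) (stalk R x C)"
  shows "tensor_push (representative x) (representative x) w \<in> locally_null x"
proof -
  let ?C = "stalk R x C" and ?s = "representative x"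
  interpret S: tensor_factors "germs x" ?C ?C by (rule stalk_factors)
  note rep = representative[of _ x]
  have sum: "?s (\<zeta> \<oplus>\<^bsub>?C\<^esub> \<zeta>') \<in> carrier C"
      "stalk_of x (?s (\<zeta> \<oplus>\<^bsub>?C\<^esub> \<zeta>')) = stalk_of x (?s \<zeta> \<oplus>\<^bsub>C\<^esub> ?s \<zeta>')"
    if \<zeta>: "\<zeta> \<in> carrier ?C" "\<zeta>' \<in> carrier ?C" for \<zeta> \<zeta>'
  proof -
    show "?s (\<zeta> \<oplus>\<^bsub>?C\<^esub> \<zeta>') \<in> carrier C" by (intro rep(1) S.add_closed_left \<zeta>)
    have "stalk_of x (?s \<zeta> \<oplus>\<^bsub>C\<^esub> ?s \<zeta>') = \<zeta> \<oplus>\<^bsub>?C\<^esub> \<zeta>'"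
      by (simp only: add_stalk[OF rep(1)[OF \<zeta>(1)] rep(1)[OF \<zeta>(2)], symmetric] rep(2) \<zeta>)
    then show "stalk_of x (?s (\<zeta> \<oplus>\<^bsub>?C\<^esub> \<zeta>')) = stalk_of x (?s \<zeta> \<oplus>\<^bsub>C\<^esub> ?s \<zeta>')"
      by (simp only: rep(2)[OF S.add_closed_left[OF \<zeta>]])
  qed
  show ?thesis using assms
  proof (induction rule: S.tensor_null_induct)
    case (rel u)
    then consider
        \<zeta> \<zeta>' \<eta> where "u = frag_of (\<zeta> \<oplus>\<^bsub>?C\<^esub> \<zeta>', \<eta>) - frag_of (\<zeta>, \<eta>) - frag_of (\<zeta>', \<eta>)"
          "\<zeta> \<in> carrier ?C" "\<zeta>' \<in> carrier ?C" "\<eta> \<in> carrier ?C"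
      | \<zeta> \<eta> \<eta>' where "u = frag_of (\<zeta>, \<eta> \<oplus>\<^bsub>?C\<^esub> \<eta>') - frag_of (\<zeta>, \<eta>) - frag_of (\<zeta>, \<eta>')"
          "\<zeta> \<in> carrier ?C" "\<eta> \<in> carrier ?C" "\<eta>' \<in> carrier ?C"
      | r \<zeta> \<eta> where "u = frag_of (r \<odot>\<^bsub>?C\<^esub> \<zeta>, \<eta>) - frag_of (\<zeta>, r \<odot>\<^bsub>?C\<^esub> \<eta>)"
          "r \<in> germs x" "\<zeta> \<in> carrier ?C" "\<eta> \<in> carrier ?C"
      unfolding tensor_relations_def by blast
    then show ?case
    proof cases
      case 1
      let ?a = "?s \<zeta>" and ?a' = "?s \<zeta>'" and ?b = "?s \<eta>" and ?c = "?s (\<zeta> \<oplus>\<^bsub>?C\<^esub> \<zeta>')"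
      have cong: "frag_of (?c, ?b) - frag_of (?a \<oplus>\<^bsub>C\<^esub> ?a', ?b) \<in> locally_null x"
        by (intro locally_null_cong sum rep(1) a_closed 1 refl)
      have "frag_of (?a \<oplus>\<^bsub>C\<^esub> ?a', ?b) - frag_of (?a, ?b) - frag_of (?a', ?b) \<in> locally_null x"
        by (intro locally_null_if_null CC.tensor_null_add_left rep(1) 1)
      from locally_null_add[OF cong this] show ?thesis by (simp add: 1(1) tensor_push_diff add_diff_eq)
    next
      case 2
      let ?a = "?s \<zeta>" and ?b = "?s \<eta>" and ?b' = "?s \<eta>'" and ?c = "?s (\<eta> \<oplus>\<^bsub>?C\<^esub> \<eta>')"
      have cong: "frag_of (?a, ?c) - frag_of (?a, ?b \<oplus>\<^bsub>C\<^esub> ?b') \<in> locally_null x"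
        by (intro locally_null_cong sum rep(1) a_closed 2 refl)
      have "frag_of (?a, ?b \<oplus>\<^bsub>C\<^esub> ?b') - frag_of (?a, ?b) - frag_of (?a, ?b') \<in> locally_null x"
        by (intro locally_null_if_null CC.tensor_null_add_right rep(1) 2)
      from locally_null_add[OF cong this] show ?thesis by (simp add: 2(1) tensor_push_diff add_diff_eq)
    next
      case 3
      \<comment> \<open>The germ r comes from an element f of \<open>R\<close>, so its action on
        classes can be lifted to the action of f on \<open>C\<close>.\<close>
      from 3(2) obtain f where f: "f \<in> carrier R" "r = germ x f" by blast
      let ?a = "?s \<zeta>" and ?b = "?s \<eta>"
      have sm: "stalk_of x (?s (r \<odot>\<^bsub>?C\<^esub> \<xi>)) = stalk_of x (f \<odot>\<^bsub>C\<^esub> ?s \<xi>)" "?s (r \<odot>\<^bsub>?C\<^esub> \<xi>) \<in> carrier C"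
        if \<xi>: "\<xi> \<in> carrier ?C" for \<xi>
      proof -
        have r\<xi>: "r \<odot>\<^bsub>?C\<^esub> \<xi> \<in> carrier ?C" by (intro S.smult_closed_left 3(2) \<xi>)
        then show "?s (r \<odot>\<^bsub>?C\<^esub> \<xi>) \<in> carrier C" by (rule rep(1))
        have "stalk_of x (f \<odot>\<^bsub>C\<^esub> ?s \<xi>) = r \<odot>\<^bsub>?C\<^esub> \<xi>"
          by (simp only: smult_stalk[OF f(1) rep(1)[OF \<xi>], symmetric] rep(2)[OF \<xi>] f(2))
        then show "stalk_of x (?s (r \<odot>\<^bsub>?C\<^esub> \<xi>)) = stalk_of x (f \<odot>\<^bsub>C\<^esub> ?s \<xi>)"
          by (simp only: rep(2)[OF r\<xi>])
      qed
      have cong: "frag_of (?s (r \<odot>\<^bsub>?C\<^esub> \<zeta>), ?b) - frag_of (f \<odot>\<^bsub>C\<^esub> ?a, ?b) \<in> locally_null x"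
        "frag_of (?a, ?s (r \<odot>\<^bsub>?C\<^esub> \<eta>)) - frag_of (?a, f \<odot>\<^bsub>C\<^esub> ?b) \<in> locally_null x"
        by (intro locally_null_cong sm smult_closed f(1) rep(1) 3 refl)+
      have "frag_of (f \<odot>\<^bsub>C\<^esub> ?a, ?b) - frag_of (?a, f \<odot>\<^bsub>C\<^esub> ?b) \<in> locally_null x"
        by (intro locally_null_if_null CC.tensor_null_balanced rep(1) 3 f(1))
      from locally_null_add[OF locally_null_diff[OF cong] this] show ?thesis
        by (simp add: 3(1) tensor_push_diff algebra_simps)
    qed
  qed (simp_all add: locally_null_zero tensor_push_diff locally_null_diff)
qed

text \<open>On a generator (a, b) the chosen representatives of the classes of a and b may differ
  from a and b, but have the same classes; differences then give all formal sums.\<close>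

lemma representative_locally_null:
  assumes "Poly_Mapping.keys u \<subseteq> carrier C \<times> carrier C"
  shows "tensor_push (representative x) (representative x)
      (tensor_push (stalk_of x) (stalk_of x) u) - u \<in> locally_null x" (is "?p u - u \<in> _")
  using assms
proof (induction u rule: frag_induction)
  case (one p)
  then show ?case
    by (cases p) (auto intro!: locally_null_cong representative simp: carrier_stalk)
next
  case (diff u v)
  have "?p (u - v) - (u - v) = (?p u - u) - (?p v - v)" by (simp add: tensor_push_diff)
  with diff show ?case using locally_null_diff by metis
qed (simp add: locally_null_zero)

text \<open>Injectivity of the canonical map from \<open>(C \<otimes>\<^sub>R C)\<^sub>x\<close> to the tensor square of \<open>C\<^sub>x\<close>.\<close>

lemma scale_null_if_stalk_tensor_null:
  assumes "Poly_Mapping.keys u \<subseteq> carrier C \<times> carrier C"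
    and "tensor_push (stalk_of x) (stalk_of x) u \<in> tensor_null (germs x) (stalk R x C) (stalk R x C)"
  obtains f where "unit_at x f" "scale f u \<in> CC.N"
proof -
  let ?p = "tensor_push (representative x) (representative x) (tensor_push (stalk_of x) (stalk_of x) u)"
  have "?p - (?p - u) \<in> locally_null x"
    by (intro locally_null_diff representative_null representative_locally_null assms)
  with that show ?thesis by (auto simp: locally_null_def)
qed

text \<open>The definition takes unions over a in the class, t in the class of \<Delta>(a), and
  formal sums in t. Replacing c by a changes the formal sum by v - u, which f annihilates since
  \<Delta> is linear; replacing \<Delta>(a) by t adds w, which g annihilates. Both become null in
  the tensor square of the stalk.\<close>

lemma stalk_comult_stalk_elt:
  assumes c: "c \<in> carrier C"
    and u: "Poly_Mapping.keys u \<subseteq> carrier C \<times> carrier C" "\<Delta> c = tensor_class (carrier R) C C u"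
  shows "stalk_comult R (germs x) x C \<Delta> (stalk_of x c) =
    tensor_class (germs x) (stalk R x C) (stalk R x C) (tensor_push (stalk_of x) (stalk_of x) u)"
    (is "_ = ?rhs")
proof -
  let ?T = "tensor (carrier R) C C" and ?C = "stalk R x C"
  interpret S: tensor_hom "carrier R" C C "germs x" ?C ?C "stalk_of x" "stalk_of x"
    by (rule stalk_hom)
  let ?M = "tensor_map (germs x) ?C ?C (stalk_of x) (stalk_of x)"
  have M: "?M t = ?rhs" if a: "a \<in> stalk_of x c" and t: "t \<in> stalk_elt R x ?T (\<Delta> a)" for a t
  proof -
    obtain f where f: "unit_at x f" "f \<odot>\<^bsub>C\<^esub> a = f \<odot>\<^bsub>C\<^esub> c" and aC: "a \<in> carrier C"
      using a c by (auto simp: mem_stalk_elt)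
    obtain v where v: "Poly_Mapping.keys v \<subseteq> carrier C \<times> carrier C" "\<Delta> a = tensor_class (carrier R) C C v"
      using comult_class[OF aC] .
    obtain h g where h: "h \<in> carrier ?T" "t = h \<oplus>\<^bsub>?T\<^esub> \<Delta> a" "unit_at x g" "g \<odot>\<^bsub>?T\<^esub> h = \<zero>\<^bsub>?T\<^esub>"
      using t by (auto simp: stalk_elt_def a_r_coset_def' stalk_null_def unit_at_def)
    obtain w where w: "Poly_Mapping.keys w \<subseteq> carrier C \<times> carrier C" "h = tensor_class (carrier R) C C w"
      using h by (auto simp: CC.carrier_tensor)
    have "scale g w \<in> CC.N"
      using h w by (simp add: smult_tensor unit_at_closed CC.zero_tensor CC.tensor_class_eq_iff)
    then have wN: "tensor_push (stalk_of x) (stalk_of x) w \<in> S.T'.N"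
      by (rule stalk_tensor_null_if_scale_null[OF h(3) w(1)])
    have "tensor_class (carrier R) C C (scale f v) = tensor_class (carrier R) C C (scale f u)"
      using comult_smult[OF unit_at_closed[OF f(1)] aC v(2)] comult_smult[OF unit_at_closed[OF f(1)] c u(2)] f(2)
      by simp
    then have "scale f (v - u) \<in> CC.N"
      by (simp add: CC.tensor_class_eq_iff scale_def tensor_push_diff)
    then have vN: "tensor_push (stalk_of x) (stalk_of x) (v - u) \<in> S.T'.N"
      using stalk_tensor_null_if_scale_null[OF f(1)] keys_diff_subset[OF v(1) u(1)] by blast
    have "t = tensor_class (carrier R) C C (w + v)" by (simp add: h(2) v w CC.add_tensor)
    then have "?M t = tensor_class (germs x) ?C ?C (tensor_push (stalk_of x) (stalk_of x) (w + v))"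
      by (simp add: S.tensor_map_class)
    also have "\<dots> = ?rhs"
      using S.T'.tensor_null_add[OF wN vN]
      by (simp add: S.T'.tensor_class_eq_iff tensor_push_add tensor_push_diff add_diff_eq)
    finally show ?thesis .
  qed
  obtain f where f: "unit_at x f" using unit_at_exists .
  \<comment> \<open>The union must also be nonempty. \<open>stalk_elt_self\<close> concerns
    \<open>C\<close>; for the tensor square, membership of \<Delta>(c) in its own class is checked
    by adding zero.\<close>
  have "\<zero>\<^bsub>?T\<^esub> \<in> stalk_null R x ?T"
    using f unit_at_closed[OF f]
    by (auto simp: stalk_null_def unit_at_def CC.zero_tensor CC.carrier_tensor smult_tensor scale_def
        intro!: bexI[of _ f])
  then have "\<Delta> c \<in> stalk_elt R x ?T (\<Delta> c)"
    by (force simp: stalk_elt_def a_r_coset_def' CC.zero_tensor CC.add_tensor u)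
  with M stalk_elt_self[OF c, of x] show ?thesis
    unfolding stalk_comult_def stalk_tensor_def stalk_map_def by blast
qed

text \<open>From fa = fc follows f \<epsilon>(a) = f \<epsilon>(c), and f can be cancelled near x,
  where it equals 1.\<close>

lemma stalk_counit_stalk_elt:
  assumes c: "c \<in> carrier C"
  shows "stalk_counit x \<epsilon> (stalk_of x c) = germ x (\<epsilon> c)"
proof -
  have "germ x (\<epsilon> a) = germ x (\<epsilon> c)" if a: "a \<in> stalk_of x c" for a
  proof -
    obtain f where f: "unit_at x f" "f \<odot>\<^bsub>C\<^esub> a = f \<odot>\<^bsub>C\<^esub> c" and aC: "a \<in> carrier C"
      using a unfolding mem_stalk_elt[OF c] by blast
    have "(\<lambda>y. f y * \<epsilon> a y) = (\<lambda>y. f y * \<epsilon> c y)"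
      using arg_cong[OF f(2), of \<epsilon>] unit_at_closed[OF f(1)] aC c by (simp only: counit_smult)
    from fun_cong[OF this] have "\<epsilon> a y = \<epsilon> c y" if "f y = 1" for y using that by (metis mult_1)
    moreover have "\<forall>\<^sub>F y in nhds x. f y = 1" using f(1) by (simp add: unit_at_def germ_eq_iff)
    ultimately show ?thesis unfolding germ_eq_iff by (rule eventually_mono[rotated])
  qed
  with stalk_elt_self[OF c, of x] show ?thesis unfolding stalk_counit_def by blast
qed

text \<open>(\<epsilon> \<otimes> id)(c \<otimes> c') is the class of (\<epsilon>(c), c'). As
  \<open>tensor_lift\<close> takes the unique element of an image, evaluation along (r, a) \<mapsto>
  ra has to be constant on that class, that is, it has to kill every relation of R \<otimes>
  C.\<close>

lemma counit_left_pure: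
  assumes c: "c \<in> carrier C" "c' \<in> carrier C" and \<Delta>: "\<Delta> c = pure_tensor (carrier R) C C c c'"
  shows "\<epsilon> c \<odot>\<^bsub>C\<^esub> c' = c"
proof -
  let ?RC = "carrier R \<times> carrier C"
  let ?\<beta> = "\<lambda>p. case p of (r, a) \<Rightarrow> r \<odot>\<^bsub>C\<^esub> a"
  have \<beta>: "?\<beta> p \<in> carrier C" if "p \<in> ?RC" for p using that smult_closed by auto
  note * = keys_diff_subset[where X = ?RC] frag_eval_diff_eq_zero[where X = ?RC and \<beta> = ?\<beta>, OF _ _ \<beta>]
  have sum: "Poly_Mapping.keys (frag_of p + frag_of q) \<subseteq> ?RC"
      "frag_eval ?\<beta> (frag_of p + frag_of q) = ?\<beta> p \<oplus>\<^bsub>C\<^esub> ?\<beta> q" if pq: "p \<in> ?RC" "q \<in> ?RC" for p q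
  proof -
    have keys: "Poly_Mapping.keys (frag_of p) \<subseteq> ?RC" "Poly_Mapping.keys (frag_of q) \<subseteq> ?RC"
      using pq by simp_all
    show "Poly_Mapping.keys (frag_of p + frag_of q) \<subseteq> ?RC" by (rule keys_add_subset[OF keys])
    show "frag_eval ?\<beta> (frag_of p + frag_of q) = ?\<beta> p \<oplus>\<^bsub>C\<^esub> ?\<beta> q"
      
      by (simp only: frag_eval_add[OF keys \<beta>] frag_eval_of[of ?\<beta>, OF \<beta>] pq)
  qed
  have null: "Poly_Mapping.keys n \<subseteq> ?RC \<and> frag_eval ?\<beta> n = \<zero>\<^bsub>C\<^esub>" if "n \<in> RC.N" for n
    using that
  proof (induction rule: RC.tensor_null_induct)
    case (rel u)
    \<comment> \<open>The subtracted generators are grouped into a sum, so that each relation is one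
      difference of two formal sums with the same value.\<close>
    then consider
        r s a where "u = frag_of (r \<oplus>\<^bsub>R\<^esub> s, a) - (frag_of (r, a) + frag_of (s, a))"
          "r \<in> carrier R" "s \<in> carrier R" "a \<in> carrier C"
      | r a b where "u = frag_of (r, a \<oplus>\<^bsub>C\<^esub> b) - (frag_of (r, a) + frag_of (r, b))"
          "r \<in> carrier R" "a \<in> carrier C" "b \<in> carrier C"
      | s r a where "u = frag_of (s \<odot>\<^bsub>R\<^esub> r, a) - frag_of (r, s \<odot>\<^bsub>C\<^esub> a)"
          "s \<in> carrier R" "r \<in> carrier R" "a \<in> carrier C"
      unfolding tensor_relations_def diff_diff_eq by blast
    then have "frag_eval ?\<beta> u = \<zero>\<^bsub>C\<^esub>"
    proof cases
      case 1
      then show ?thesis using smult_l_distr[of r s a] unfolding 1(1)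
        by (intro *(2) sum(1)) (simp_all add: sum(2) smult_closed add_closed)
    next
      case 2
      then show ?thesis using smult_r_distr[of r a b] unfolding 2(1)
        by (intro *(2) sum(1)) (simp_all add: sum(2) smult_closed add_closed)
    next
      case 3
      then show ?thesis using smult_mult[of s r a] smult_commute[of s r a] unfolding 3(1)
        by (intro *(2)) (auto simp: smult_closed mult_closed)
    qed
    then show ?case using RC.keys_tensor_relations[OF rel] by simp
  next
    case zero
    then show ?case by (simp add: frag_eval_def)
  next
    case (diff u v)
    then show ?case using *(1)[of u v] *(2)[of u v] by simp
  qed
  let ?e = "frag_of (\<epsilon> c, c')"
  have e: "\<epsilon> c \<in> carrier R" "Poly_Mapping.keys ?e \<subseteq> ?RC" using c counit_closed by auto
  have "frag_eval ?\<beta> u = \<epsilon> c \<odot>\<^bsub>C\<^esub> c'" if "u \<in> tensor_class (carrier R) R C ?e" for u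
    using that null frag_eval_add[OF _ e(2) \<beta>] e(1) c
    by (auto simp: RC.tensor_class_eq smult_closed)
  then have "frag_eval ?\<beta> ` tensor_class (carrier R) R C ?e
      = (\<lambda>_. \<epsilon> c \<odot>\<^bsub>C\<^esub> c') ` tensor_class (carrier R) R C ?e"
    by (intro image_cong refl)
  also have "\<dots> = {\<epsilon> c \<odot>\<^bsub>C\<^esub> c'}" by (rule image_constant[OF RC.tensor_class_self])
  finally have "frag_eval ?\<beta> ` tensor_class (carrier R) R C ?e = {\<epsilon> c \<odot>\<^bsub>C\<^esub> c'}" .
  moreover have "tensor_map (carrier R) R C \<epsilon> (\<lambda>a. a) (\<Delta> c) = tensor_class (carrier R) R C ?e"
    unfolding \<Delta> pure_tensor_def tensor_hom.tensor_map_class[OF counit_hom] by simp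
  moreover have "tensor_lift C (\<lambda>r c. r \<odot>\<^bsub>C\<^esub> c) t = the_elem (frag_eval ?\<beta> ` t)" for t
    unfolding tensor_lift_def frag_eval_def by (simp add: case_prod_beta')
  ultimately show ?thesis using counit_left[OF c(1)] by simp
qed

section \<open>The three statements over a ring of functions\<close>

theorem stalk_grouplike_if_weakly_grouplike:
  assumes "c \<in> weakly_grouplike R C \<Delta>" and norm: "germ x (\<epsilon> c) = germ x (\<lambda>_. 1)"
  shows "stalk_of x c \<in> stalk_grouplike R (germs x) x C \<Delta> \<epsilon>"
proof -
  obtain c' where c: "c \<in> carrier C" "c' \<in> carrier C" and \<Delta>: "\<Delta> c = pure_tensor (carrier R) C C c c'"
    using assms by (auto simp: weakly_grouplike_def)
  have "stalk_of x c' = stalk_of x c"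
    using stalk_elt_smult_unit[of x "\<epsilon> c" c'] counit_left_pure[OF c \<Delta>] c norm counit_closed
    by (simp add: unit_at_def)
  then have "stalk_comult R (germs x) x C \<Delta> (stalk_of x c)
      = pure_tensor (germs x) (stalk R x C) (stalk R x C) (stalk_of x c) (stalk_of x c)"
    using stalk_comult_stalk_elt[of c "frag_of (c, c')" x] c \<Delta> by (simp add: pure_tensor_def)
  then show ?thesis
    using c norm by (simp add: stalk_grouplike_def carrier_stalk stalk_counit_stalk_elt)
qed

theorem stalk_elt_eq_nearby:
  assumes "c \<in> carrier C" "d \<in> carrier C" "stalk_of x c = stalk_of x d"
  obtains W where "open W" "x \<in> W" "\<And>y. y \<in> W \<Longrightarrow> stalk_of y c = stalk_of y d"
proof -
  obtain f where f: "unit_at x f" "f \<odot>\<^bsub>C\<^esub> c = f \<odot>\<^bsub>C\<^esub> d"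
    using assms by (auto simp: stalk_elt_eq_iff)
  then obtain W where W: "open W" "x \<in> W" "\<forall>y\<in>W. f y = 1"
    by (auto simp: unit_at_def germ_eq_iff eventually_nhds)
  then have "unit_at y f" if "y \<in> W" for y
    using f(1) that by (auto simp: unit_at_def germ_eq_iff eventually_nhds)
  then have "stalk_of y c = stalk_of y d" if "y \<in> W" for y
    using that f(2) stalk_elt_eq_iff[OF assms(1,2)] by blast
  with W(1,2) that show ?thesis by blast
qed

theorem weakly_grouplike_if_stalk_grouplike:
  assumes c: "c \<in> carrier C" and G: "stalk_of x c \<in> stalk_grouplike R (germs x) x C \<Delta> \<epsilon>"
  obtains U f where "open U" "x \<in> U" "normalized_on \<epsilon> c U"
    "unit_at x f" "closure {y. f y \<noteq> 0} \<subseteq> U" "f \<odot>\<^bsub>C\<^esub> c \<in> weakly_grouplike R C \<Delta>"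
proof -
  interpret S: tensor_factors "germs x" "stalk R x C" "stalk R x C" by (rule stalk_factors)
  have "germ x (\<epsilon> c) = germ x (\<lambda>_. 1)"
    using G c by (simp add: stalk_grouplike_def stalk_counit_stalk_elt)
  then obtain U where U: "open U" "x \<in> U" "\<forall>y\<in>U. \<epsilon> c y = 1"
    by (auto simp: germ_eq_iff eventually_nhds)
  then have norm: "normalized_on \<epsilon> c U"
    by (auto simp: normalized_on_def germ_eq_iff eventually_nhds)
  obtain u where u: "Poly_Mapping.keys u \<subseteq> carrier C \<times> carrier C" "\<Delta> c = tensor_class (carrier R) C C u"
    using comult_class[OF c] .
  let ?v = "u - frag_of (c, c)"
  have keys: "Poly_Mapping.keys ?v \<subseteq> carrier C \<times> carrier C" using u c by (intro keys_diff_subset) auto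
  have "tensor_push (stalk_of x) (stalk_of x) ?v \<in> S.N"
    using G stalk_comult_stalk_elt[OF c u, of x]
    by (simp add: stalk_grouplike_def pure_tensor_def S.tensor_class_eq_iff tensor_push_diff)
  then obtain h where h: "unit_at x h" "scale h ?v \<in> CC.N"
    using scale_null_if_stalk_tensor_null[OF keys] by blast
  \<comment> \<open>Both conditions are imposed on the support of f: lying in U gives the required
    support, and h = 1 there gives fh = f, so that f inherits from h the annihilation of
    \<open>?v\<close>.\<close>
  have near: "\<forall>\<^sub>F y in nhds x. y \<in> U \<and> h y = 1"
    using h(1) U by (intro eventually_conj eventually_nhds_in_open) (auto simp: unit_at_def germ_eq_iff)
  obtain f where f: "unit_at x f" "closure {y. f y \<noteq> 0} \<subseteq> {y. y \<in> U \<and> h y = 1}"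
      "\<forall>y. f y \<noteq> 0 \<longrightarrow> y \<in> U \<and> h y = 1"
    using absorbing_unit_at[OF near] .
  note fR = unit_at_closed[OF f(1)] and hR = unit_at_closed[OF h(1)]
  have "(\<lambda>y. f y * h y) = f"
  proof
    fix y show "f y * h y = f y" by (cases "f y = 0") (simp_all add: f(3))
  qed
  then have "scale f ?v = scale f (scale h ?v)" using scale_scale[OF fR hR keys] by simp
  also have "\<dots> \<in> CC.N" using scale_null[OF fR h(2)] .
  finally have "\<Delta> (f \<odot>\<^bsub>C\<^esub> c) = pure_tensor (carrier R) C C (f \<odot>\<^bsub>C\<^esub> c) c"
    using comult_smult[OF fR c u(2)]
    by (simp add: pure_tensor_def CC.tensor_class_eq_iff scale_def tensor_push_diff)
  then have "f \<odot>\<^bsub>C\<^esub> c \<in> weakly_grouplike R C \<Delta>"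
    using fR c smult_closed by (auto simp: weakly_grouplike_def)
  with that U norm f show ?thesis by blast
qed

end

section \<open>Smooth functions and bump functions\<close>

lemma Ck_on_cong:
  "(\<And>p. p \<in> S \<Longrightarrow> f p = g p) \<Longrightarrow> Ck_on k E S f \<longleftrightarrow> Ck_on k E S g"
proof (induction k)
  case 0
  then show ?case by (simp cong: continuous_on_cong)
next
  case (Suc k)
  have "(f has_derivative D) (at p within S) \<longleftrightarrow> (g has_derivative D) (at p within S)" if "p \<in> S" for p D
    using that Suc.prems by (auto intro: has_derivative_transform[rotated 2])
  then show ?case by (simp cong: conj_cong)
qed

lemma Ck_on_subset: "Ck_on k E S f \<Longrightarrow> T \<subseteq> S \<Longrightarrow> Ck_on k E T f"
proof (induction k arbitrary: f)
  case 0
  then show ?case by (auto intro: continuous_on_subset)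
next
  case (Suc k)
  obtain f' where "\<forall>p\<in>S. (f has_derivative f' p) (at p within S)"
      "\<forall>v\<in>E. Ck_on k E S (\<lambda>p. f' p v)"
    using Suc.prems(1) unfolding Ck_on.simps(2) by blast
  then show ?case using Suc.IH Suc.prems(2) has_derivative_subset
    unfolding Ck_on.simps(2) by (intro exI[of _ f']) blast
qed

lemma Ck_on_imp_continuous_on: "Ck_on k E S f \<Longrightarrow> continuous_on S f"
  by (cases k) (auto simp: continuous_on_eq_continuous_within intro: has_derivative_continuous)

lemma Ck_on_SucD: "Ck_on (Suc k) E S f \<Longrightarrow> Ck_on k E S f"
proof (induction k arbitrary: f)
  case 0
  then show ?case using Ck_on_imp_continuous_on[OF 0] by simp
next
  case (Suc k)
  obtain f' where "\<forall>p\<in>S. (f has_derivative f' p) (at p within S)"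
      "\<forall>v\<in>E. Ck_on (Suc k) E S (\<lambda>p. f' p v)"
    using Suc.prems unfolding Ck_on.simps(2)[of "Suc k"] by blast
  then show ?case using Suc.IH unfolding Ck_on.simps(2)[of k E S f] by (intro exI[of _ f']) blast
qed

lemma Ck_on_SucI:
  assumes "\<And>p. p \<in> S \<Longrightarrow> (f has_derivative f' p) (at p within S)"
    and "\<And>v. v \<in> E \<Longrightarrow> Ck_on k E S (\<lambda>p. f' p v)"
  shows "Ck_on (Suc k) E S f"
  unfolding Ck_on.simps(2) using assms by (intro exI[of _ f']) blast

declare Ck_on.simps(2) [simp del]

lemma Ck_on_const: "Ck_on k E S (\<lambda>_. c)"
proof (induction k arbitrary: c)
  case (Suc k)
  show ?case by (rule Ck_on_SucI[where f' = "\<lambda>_ _. 0"]) (auto simp: Suc)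
qed auto

lemma Ck_on_add: "Ck_on k E S f \<Longrightarrow> Ck_on k E S g \<Longrightarrow> Ck_on k E S (\<lambda>p. f p + g p)"
proof (induction k arbitrary: f g)
  case (Suc k)
  obtain f' where f': "\<And>p. p \<in> S \<Longrightarrow> (f has_derivative f' p) (at p within S)"
    "\<And>v. v \<in> E \<Longrightarrow> Ck_on k E S (\<lambda>p. f' p v)" using Suc.prems(1) unfolding Ck_on.simps(2) by blast
  obtain g' where g': "\<And>p. p \<in> S \<Longrightarrow> (g has_derivative g' p) (at p within S)"
    "\<And>v. v \<in> E \<Longrightarrow> Ck_on k E S (\<lambda>p. g' p v)" using Suc.prems(2) unfolding Ck_on.simps(2) by blast
  show ?case
    by (rule Ck_on_SucI[where f' = "\<lambda>p v. f' p v + g' p v"])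
      (auto intro!: has_derivative_add f' g' Suc.IH)
qed (auto intro: continuous_intros)

lemma Ck_on_sum: "(\<And>i. i \<in> I \<Longrightarrow> Ck_on k E S (f i)) \<Longrightarrow> Ck_on k E S (\<lambda>p. \<Sum>i\<in>I. f i p)"
  by (induction I rule: infinite_finite_induct) (auto simp: Ck_on_const Ck_on_add)

lemma Ck_on_bounded_linear:
  assumes "bounded_linear L"
  shows "Ck_on k E S f \<Longrightarrow> Ck_on k E S (\<lambda>p. L (f p))"
proof (induction k arbitrary: f)
  case 0
  then show ?case by (simp add: bounded_linear.continuous_on[OF assms])
next
  case (Suc k)
  obtain f' where f': "\<And>p. p \<in> S \<Longrightarrow> (f has_derivative f' p) (at p within S)"
    "\<And>v. v \<in> E \<Longrightarrow> Ck_on k E S (\<lambda>p. f' p v)" using Suc.prems unfolding Ck_on.simps(2) by blast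
  show ?case
    by (rule Ck_on_SucI[where f' = "\<lambda>p v. L (f' p v)"])
      (auto intro!: bounded_linear.has_derivative[OF assms] f' Suc.IH)
qed

lemma Ck_on_mult:
  fixes f g :: "'e::euclidean_space \<Rightarrow> 'b::real_normed_algebra"
  shows "Ck_on k E S f \<Longrightarrow> Ck_on k E S g \<Longrightarrow> Ck_on k E S (\<lambda>p. f p * g p)"
proof (induction k arbitrary: f g)
  case (Suc k)
  obtain f' where f': "\<And>p. p \<in> S \<Longrightarrow> (f has_derivative f' p) (at p within S)"
    "\<And>v. v \<in> E \<Longrightarrow> Ck_on k E S (\<lambda>p. f' p v)" using Suc.prems(1) unfolding Ck_on.simps(2) by blast
  obtain g' where g': "\<And>p. p \<in> S \<Longrightarrow> (g has_derivative g' p) (at p within S)"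
    "\<And>v. v \<in> E \<Longrightarrow> Ck_on k E S (\<lambda>p. g' p v)" using Suc.prems(2) unfolding Ck_on.simps(2) by blast
  show ?case
    by (rule Ck_on_SucI[where f' = "\<lambda>p v. f p * g' p v + f' p v * g p"])
      (auto intro!: has_derivative_mult f' g' Ck_on_add Suc.IH Suc.prems[THEN Ck_on_SucD])
qed (auto intro: continuous_intros)

text \<open>The derivative is a product of u' with two copies of 1/u, and 1/u is of class C^k by the
  induction hypothesis.\<close>

lemma Ck_on_inverse:
  fixes u :: "'e::euclidean_space \<Rightarrow> real"
  assumes "\<And>p. p \<in> S \<Longrightarrow> u p \<noteq> 0"
  shows "Ck_on k E S u \<Longrightarrow> Ck_on k E S (\<lambda>p. inverse (u p))"
proof (induction k)
  case 0
  then show ?case using assms by (auto intro!: continuous_intros)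
next
  case (Suc k)
  obtain u' where u': "\<And>p. p \<in> S \<Longrightarrow> (u has_derivative u' p) (at p within S)"
    "\<And>v. v \<in> E \<Longrightarrow> Ck_on k E S (\<lambda>p. u' p v)" using Suc.prems unfolding Ck_on.simps(2) by blast
  have IH: "Ck_on k E S (\<lambda>p. inverse (u p))" by (rule Suc.IH[OF Ck_on_SucD[OF Suc.prems]])
  show ?case
  proof (rule Ck_on_SucI[where f' = "\<lambda>p v. - (inverse (u p) * u' p v * inverse (u p))"])
    show "((\<lambda>p. inverse (u p)) has_derivative (\<lambda>v. - (inverse (u p) * u' p v * inverse (u p)))) (at p within S)"
      if "p \<in> S" for p using that by (intro Deriv.has_derivative_inverse u'(1) assms)
    show "Ck_on k E S (\<lambda>p. - (inverse (u p) * u' p v * inverse (u p)))" if "v \<in> E" for v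
      by (intro Ck_on_bounded_linear[OF bounded_linear_minus[OF bounded_linear_ident]]
          Ck_on_mult IH u'(2) that)
  qed
qed

text \<open>Taking a whole sequence of successive derivatives, with n arbitrary, closes the
  induction: the chain rule for \<open>D n\<close> produces \<open>D (Suc n)\<close> composed with
  u.\<close>

lemma Ck_on_compose_real:
  fixes u :: "'e::euclidean_space \<Rightarrow> real" and D :: "nat \<Rightarrow> real \<Rightarrow> real"
  assumes D: "\<And>n t. (D n has_real_derivative D (Suc n) t) (at t)"
  shows "Ck_on k E S u \<Longrightarrow> Ck_on k E S (\<lambda>p. D n (u p))"
proof (induction k arbitrary: n)
  case 0
  have "continuous_on UNIV (D n)" using D by (meson DERIV_isCont continuous_at_imp_continuous_on)
  with 0 show ?case by (auto intro: continuous_on_compose2)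
next
  case (Suc k)
  obtain u' where u': "\<And>p. p \<in> S \<Longrightarrow> (u has_derivative u' p) (at p within S)"
    "\<And>v. v \<in> E \<Longrightarrow> Ck_on k E S (\<lambda>p. u' p v)" using Suc.prems unfolding Ck_on.simps(2) by blast
  show ?case
  proof (rule Ck_on_SucI[where f' = "\<lambda>p v. D (Suc n) (u p) * u' p v"])
    show "((\<lambda>p. D n (u p)) has_derivative (\<lambda>v. D (Suc n) (u p) * u' p v)) (at p within S)" if "p \<in> S" for p
      using has_derivative_compose[OF u'(1)[OF that] D[unfolded has_field_derivative_def, of n "u p"]]
      by simp
    show "Ck_on k E S (\<lambda>p. D (Suc n) (u p) * u' p v)" if "v \<in> E" for v
      by (intro Ck_on_mult u'(2) that Suc.IH Ck_on_SucD[OF Suc.prems])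
  qed
qed

text \<open>The line through p in direction v stays in E, hence meets S in an open set of
  parameters. Along it both derivatives restrict to the derivative of a function of one real
  variable, which is unique.\<close>

lemma has_derivative_unique_on_subspace:
  fixes f :: "'e::euclidean_space \<Rightarrow> 'b::real_normed_vector"
  assumes E: "subspace E" "openin (top_of_set E) S" and pv: "p \<in> S" "v \<in> E"
    and D: "(f has_derivative D) (at p within S)" and D': "(f has_derivative D') (at p within S)"
  shows "D v = D' v"
proof -
  let ?\<gamma> = "\<lambda>t::real. p + t *\<^sub>R v"
  obtain O' where O': "open O'" "S = E \<inter> O'" using E(2) by (auto simp: openin_open)
  have cont: "continuous_on UNIV ?\<gamma>" by (intro continuous_intros)
  have "?\<gamma> -` S = ?\<gamma> -` O'"
    using pv E(1) O' by (auto simp: subspace_add subspace_scale)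
  then have op: "open (?\<gamma> -` S)" using open_vimage[OF O'(1) cont] by simp
  have 0: "0 \<in> ?\<gamma> -` S" using pv by simp
  have "((f \<circ> ?\<gamma>) has_derivative (X \<circ> (\<lambda>t. t *\<^sub>R v))) (at 0)"
    if X: "(f has_derivative X) (at p within S)" for X
  proof -
    have "(f has_derivative X) (at (?\<gamma> 0) within ?\<gamma> ` (?\<gamma> -` S))"
      using has_derivative_subset[OF X, of "?\<gamma> ` (?\<gamma> -` S)"] by (simp add: image_vimage_subset)
    moreover have "(?\<gamma> has_derivative (\<lambda>t. t *\<^sub>R v)) (at 0 within ?\<gamma> -` S)"
      by (auto intro!: derivative_eq_intros)
    ultimately have "((f \<circ> ?\<gamma>) has_derivative (X \<circ> (\<lambda>t. t *\<^sub>R v))) (at 0 within ?\<gamma> -` S)"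
      by (intro diff_chain_within)
    then show ?thesis using at_within_open[OF 0 op] by simp
  qed
  from has_derivative_unique[OF this[OF D] this[OF D']] show ?thesis by (auto dest: fun_cong[of _ _ 1])
qed

lemma at_within_openin_subset:
  assumes "openin (top_of_set E) T" "p \<in> T" "T \<subseteq> S" "S \<subseteq> E"
  shows "at p within S = at p within T"
proof -
  obtain O' where O': "open O'" "T = E \<inter> O'" using assms(1) by (auto simp: openin_open)
  with assms show ?thesis by (intro at_within_nhd[of p O']) auto
qed

text \<open>\<open>Ck_on\<close> only asserts that some derivative exists, so the neighbourhoods
  \<open>T p\<close> come with unrelated derivatives \<open>D p\<close>. They are glued along the
  diagonal, as \<open>D p p\<close>; uniqueness in directions of E makes this agree with
  \<open>D p\<close> on all of \<open>T p\<close>, which passes regularity on to the next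
  order.\<close>

lemma Ck_on_local:
  assumes E: "subspace E"
    and "\<And>p. p \<in> S \<Longrightarrow> \<exists>T. openin (top_of_set E) T \<and> p \<in> T \<and> T \<subseteq> S \<and> Ck_on k E T f"
  shows "Ck_on k E S f"
  using assms(2)
proof (induction k arbitrary: f)
  case 0
  then have "S \<subseteq> E" using openin_imp_subset by blast
  have "continuous (at p within S) f" if p: "p \<in> S" for p
  proof -
    obtain T where T: "openin (top_of_set E) T" "p \<in> T" "T \<subseteq> S" "continuous_on T f"
      using 0 p by force
    with at_within_openin_subset[OF T(1-3) \<open>S \<subseteq> E\<close>] show ?thesis
      by (simp add: continuous_on_eq_continuous_within)
  qed
  then show ?case by (simp add: continuous_on_eq_continuous_within)
next
  case (Suc k)
  then obtain T where T: "\<And>p. p \<in> S \<Longrightarrow> openin (top_of_set E) (T p) \<and> p \<in> T p \<and> T p \<subseteq> S \<and> Ck_on (Suc k) E (T p) f"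
    by metis
  have "\<exists>D. (\<forall>q\<in>T p. (f has_derivative D q) (at q within T p)) \<and> (\<forall>v\<in>E. Ck_on k E (T p) (\<lambda>q. D q v))"
    if "p \<in> S" for p
    using T[OF that] by (simp add: Ck_on.simps(2))
  then obtain D where D: "\<And>p q. p \<in> S \<Longrightarrow> q \<in> T p \<Longrightarrow> (f has_derivative D p q) (at q within T p)"
      "\<And>p v. p \<in> S \<Longrightarrow> v \<in> E \<Longrightarrow> Ck_on k E (T p) (\<lambda>q. D p q v)"
    by metis
  have "S \<subseteq> E" using T openin_imp_subset by blast
  have DS: "(f has_derivative D p q) (at q within S)" if "p \<in> S" "q \<in> T p" for p q
    using D(1)[OF that] T[OF that(1)] that(2) at_within_openin_subset[of E "T p" q S] \<open>S \<subseteq> E\<close>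
    by simp
  have S: "openin (top_of_set E) S"
    using T by (subst openin_subopen) blast
  show ?case
  proof (rule Ck_on_SucI[where f' = "\<lambda>p. D p p"])
    show "(f has_derivative D p p) (at p within S)" if p: "p \<in> S" for p
      using DS T p by blast
    show "Ck_on k E S (\<lambda>p. D p p v)" if "v \<in> E" for v
    proof (rule Suc.IH)
      fix p assume p: "p \<in> S"
      have "D p q v = D q q v" if q: "q \<in> T p" for q
      proof -
        have "q \<in> S" using T p q by blast
        with DS[OF p q] DS[of q q] T[of q] \<open>v \<in> E\<close> show ?thesis
          using has_derivative_unique_on_subspace[OF E S] by blast
      qed
      then have "Ck_on k E (T p) (\<lambda>q. D q q v)"
        using D(2)[OF p \<open>v \<in> E\<close>] Ck_on_cong[of "T p" "\<lambda>q. D p q v" "\<lambda>q. D q q v"] by simp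
      then show "\<exists>T. openin (top_of_set E) T \<and> p \<in> T \<and> T \<subseteq> S \<and> Ck_on k E T (\<lambda>q. D q q v)"
        using T[OF p] by blast
    qed
  qed
qed

text \<open>With w = 1/t, differentiating P(w) exp(-w) in t gives w^2 (P(w) - P'(w)) exp(-w); the
  recursion records the polynomial factor.\<close>

fun flat_poly :: "nat \<Rightarrow> real poly" where
  "flat_poly 0 = 1"
| "flat_poly (Suc n) = monom 1 2 * (flat_poly n - pderiv (flat_poly n))"

text \<open>The \<open>n\<close>-th derivative of the function that is \<open>exp (- 1 / t)\<close> for \<open>t > 0\<close> and zero elsewhere.\<close>

definition flat :: "nat \<Rightarrow> real \<Rightarrow> real"
  where "flat n t = (if t > 0 then poly (flat_poly n) (1 / t) * exp (- (1 / t)) else 0)"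

lemma poly_times_exp_minus_tendsto_0:
  "((\<lambda>w::real. poly q w * exp (- w)) \<longlongrightarrow> 0) at_top"
proof -
  have "((\<lambda>w::real. \<Sum>i\<le>degree q. coeff q i * (w ^ i / exp w)) \<longlongrightarrow> (\<Sum>i\<le>degree q. coeff q i * 0)) at_top"
    by (intro tendsto_intros tendsto_power_div_exp_0)
  then show ?thesis
    by (simp add: poly_altdef sum_distrib_right exp_minus divide_inverse mult.assoc)
qed

lemma has_real_derivative_flat: "(flat n has_real_derivative flat (Suc n) t) (at t)"
proof -
  consider "t > 0" | "t < 0" | "t = 0" by linarith
  then show ?thesis
  proof cases
    case 1
    have "((\<lambda>t. poly (flat_poly n) (1 / t) * exp (- (1 / t))) has_real_derivative flat (Suc n) t) (at t)"
      using 1 by (auto intro!: derivative_eq_intros DERIV_chain2[OF poly_DERIV]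
          simp: flat_def poly_monom field_simps power2_eq_square)
    then show ?thesis
      by (rule has_field_derivative_transform_within_open[where S = "{0<..}"])
        (use 1 in \<open>auto simp: flat_def\<close>)
  next
    case 2
    have "((\<lambda>_. 0) has_real_derivative flat (Suc n) t) (at t)" using 2 by (simp add: flat_def)
    then show ?thesis
      by (rule has_field_derivative_transform_within_open[where S = "{..<0}"])
        (use 2 in \<open>auto simp: flat_def\<close>)
  next
    case 3
    \<comment> \<open>The difference quotient at 0 from the right is w P(w) exp(-w) with w = 1/y
      tending to infinity; \<open>pCons 0\<close> supplies the additional factor w.\<close>
    have "((\<lambda>y. poly (pCons 0 (flat_poly n)) (inverse y) * exp (- inverse y)) \<longlongrightarrow> 0) (at_right (0::real))"
      using filterlim_compose[OF poly_times_exp_minus_tendsto_0 filterlim_inverse_at_top_right] .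
    then have "((\<lambda>y. flat n y / y) \<longlongrightarrow> 0) (at_right 0)"
      by (rule Lim_transform_eventually)
        (auto simp: eventually_at_filter flat_def field_simps intro!: always_eventually)
    moreover have "((\<lambda>y. flat n y / y) \<longlongrightarrow> 0) (at_left 0)"
      by (rule tendsto_eventually) (auto simp: eventually_at_filter flat_def)
    ultimately show ?thesis
      using 3 by (auto simp: has_field_derivative_iff flat_def[of _ 0] filterlim_split_at)
  qed
qed

lemma flat_0_pos: "t > 0 \<Longrightarrow> flat 0 t > 0" and flat_0_nonpos: "t \<le> 0 \<Longrightarrow> flat 0 t = 0"
  and flat_0_nonneg: "flat 0 t \<ge> 0"
  by (auto simp: flat_def)

text \<open>The distance is squared to be smooth at z. The summand with s - 1/4 vanishes up to
  distance r/2, where the quotient is therefore 1, and the numerator vanishes from distance r on.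
  The denominator is never 0, since 1 - s and s - 1/4 have a positive sum.\<close>

definition bump_function :: "'e::euclidean_space \<Rightarrow> real \<Rightarrow> 'e \<Rightarrow> real"
  where "bump_function z r y =
    (let s = (dist y z / r)\<^sup>2 in flat 0 (1 - s) * inverse (flat 0 (1 - s) + flat 0 (s - 1 / 4)))"

lemma bump_function_eq_1:
  assumes "r > 0" "y \<in> ball z (r / 2)" shows "bump_function z r y = 1"
proof -
  have "dist y z / r < 1 / 2" using assms by (simp add: field_simps dist_commute)
  then have "(dist y z / r)\<^sup>2 < (1 / 2)\<^sup>2" using assms by (intro power_strict_mono) auto
  then have "(dist y z / r)\<^sup>2 < 1 / 4" by (simp add: power2_eq_square)
  then have "flat 0 (1 - (dist y z / r)\<^sup>2) > 0" "flat 0 ((dist y z / r)\<^sup>2 - 1 / 4) = 0"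
    using flat_0_pos flat_0_nonpos by simp_all
  then show ?thesis unfolding bump_function_def Let_def by simp
qed

lemma bump_function_eq_0:
  assumes "r > 0" "y \<notin> ball z r" shows "bump_function z r y = 0"
proof -
  have "1 \<le> dist y z / r" using assms by (simp add: field_simps dist_commute)
  then have "1 \<le> (dist y z / r)\<^sup>2" by (simp add: one_le_power)
  then show ?thesis by (simp add: bump_function_def Let_def flat_0_nonpos)
qed

lemma Ck_on_bump_function:
  fixes g :: "'a::euclidean_space \<Rightarrow> 'e::euclidean_space"
  assumes "Ck_on k E S g"
  shows "Ck_on k E S (\<lambda>p. bump_function z r (g p))"
proof -
  \<comment> \<open>Written as a polynomial in the coordinates of \<open>g p\<close>, using sums and
    products only, the squared distance falls under the closure rules for
    \<open>Ck_on\<close>.\<close>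
  have sq: "(dist (g p) z / r)\<^sup>2 = (\<Sum>b\<in>Basis. (g p \<bullet> b + - (z \<bullet> b)) * (g p \<bullet> b + - (z \<bullet> b))) * (1 / r\<^sup>2)" for p
  proof -
    have "(g p - z) \<bullet> (g p - z) = (\<Sum>b\<in>Basis. (g p \<bullet> b + - (z \<bullet> b)) * (g p \<bullet> b + - (z \<bullet> b)))"
      by (subst euclidean_inner) (simp add: inner_diff_left)
    then show ?thesis by (simp add: dist_norm power_divide power2_norm_eq_inner)
  qed
  let ?s = "\<lambda>p. (dist (g p) z / r)\<^sup>2"
  have s: "Ck_on k E S ?s"
    unfolding sq
    by (intro Ck_on_mult Ck_on_sum Ck_on_add Ck_on_const
        Ck_on_bounded_linear[OF bounded_linear_inner_left] assms)
  have 1: "Ck_on k E S (\<lambda>p. flat 0 (1 + - 1 * ?s p))" "Ck_on k E S (\<lambda>p. flat 0 (?s p + - 1 / 4))"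
    by (intro Ck_on_compose_real[where D = flat] has_real_derivative_flat Ck_on_add Ck_on_mult Ck_on_const s)+
  have "flat 0 (1 + - 1 * t) + flat 0 (t + - 1 / 4) \<noteq> 0" for t
    using flat_0_pos[of "1 + - 1 * t"] flat_0_pos[of "t + - 1 / 4"] flat_0_nonneg[of "1 + - 1 * t"]
      flat_0_nonneg[of "t + - 1 / 4"] by linarith
  then have "Ck_on k E S (\<lambda>p. flat 0 (1 + - 1 * ?s p) * inverse (flat 0 (1 + - 1 * ?s p) + flat 0 (?s p + - 1 / 4)))"
    by (intro Ck_on_mult Ck_on_inverse Ck_on_add 1)
  then show ?thesis by (simp add: bump_function_def Let_def)
qed

section \<open>Smooth functions with compact support on a manifold\<close>

locale manifold =
  fixes F :: "complex set" and E :: "'e::euclidean_space set" and A :: "('m::t2_space, 'e) atlas"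
  assumes scalars: "F = \<real> \<or> F = UNIV" and smooth_manifold: "smooth_manifold E A"
begin

abbreviation "smooth \<equiv> smooth_functions F E A"

lemma subspace: "subspace E"
  using smooth_manifold by (simp add: smooth_manifold_def)

lemma chart_at: obtains U \<phi> where "(U, \<phi>) \<in> A" "x \<in> U"
proof -
  have "x \<in> (\<Union>(U, \<phi>)\<in>A. U)" using smooth_manifold by (simp add: smooth_manifold_def)
  with that show ?thesis by auto
qed

lemma open_chart: "(U, \<phi>) \<in> A \<Longrightarrow> open U"
  and openin_chart: "(U, \<phi>) \<in> A \<Longrightarrow> openin (top_of_set E) (\<phi> ` U)"
  and homeomorphism_chart: "(U, \<phi>) \<in> A \<Longrightarrow> homeomorphism U (\<phi> ` U) \<phi> (inv_into U \<phi>)"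
  using smooth_manifold[unfolded smooth_manifold_def, THEN conjunct2, THEN conjunct2, THEN conjunct1,
      THEN bspec, of "(U, \<phi>)"] by simp_all

lemma transition:
  "(U, \<phi>) \<in> A \<Longrightarrow> (V, \<psi>) \<in> A \<Longrightarrow> Cinf_on E (\<phi> ` (U \<inter> V)) (\<psi> \<circ> inv_into U \<phi>)"
  using smooth_manifold[unfolded smooth_manifold_def, THEN conjunct2, THEN conjunct2, THEN conjunct2,
      THEN bspec, of "(U, \<phi>)"] by auto

lemma chart_inverse: "(U, \<phi>) \<in> A \<Longrightarrow> y \<in> U \<Longrightarrow> inv_into U \<phi> (\<phi> y) = y"
  using homeomorphism_apply1[OF homeomorphism_chart] .

lemma openin_chart_image:
  assumes "(U, \<phi>) \<in> A" "open W"
  shows "openin (top_of_set E) (\<phi> ` (U \<inter> W))"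
proof -
  have "openin (top_of_set (\<phi> ` U)) (\<phi> ` (U \<inter> W))"
    by (intro homeomorphism_imp_open_map[OF homeomorphism_chart[OF assms(1)]] openin_open_Int assms)
  then show ?thesis using openin_chart[OF assms(1)] by (rule openin_trans)
qed

lemma smooth_cong:
  assumes "f \<in> smooth W" "\<And>y. y \<in> W \<Longrightarrow> f y = g y"
  shows "g \<in> smooth W"
proof -
  have "Cinf_on E (\<phi> ` (U \<inter> W)) (g \<circ> inv_into U \<phi>)" if "(U, \<phi>) \<in> A" for U \<phi>
  proof -
    have "Ck_on k E (\<phi> ` (U \<inter> W)) (f \<circ> inv_into U \<phi>) = Ck_on k E (\<phi> ` (U \<inter> W)) (g \<circ> inv_into U \<phi>)" for k
      using assms(2) chart_inverse[OF that] by (intro Ck_on_cong) auto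
    then show ?thesis using assms(1) that by (auto simp: smooth_functions_def Cinf_on_def)
  qed
  then show ?thesis using assms by (auto simp: smooth_functions_def)
qed

lemma smooth_subset: "f \<in> smooth W \<Longrightarrow> W' \<subseteq> W \<Longrightarrow> f \<in> smooth W'"
  unfolding smooth_functions_def Cinf_on_def
  using Ck_on_subset[OF _ image_mono[OF Int_mono[OF order_refl]]] by blast

lemma smooth_local:
  assumes "\<And>y. y \<in> W \<Longrightarrow> \<exists>V. open V \<and> y \<in> V \<and> V \<subseteq> W \<and> f \<in> smooth V"
  shows "f \<in> smooth W"
proof -
  have "Ck_on k E (\<phi> ` (U \<inter> W)) (f \<circ> inv_into U \<phi>)" if U: "(U, \<phi>) \<in> A" for U \<phi> k
  proof (rule Ck_on_local[OF subspace])
    fix p assume "p \<in> \<phi> ` (U \<inter> W)"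
    then obtain y where y: "y \<in> U" "y \<in> W" "p = \<phi> y" by blast
    with assms obtain V where V: "open V" "y \<in> V" "V \<subseteq> W" "f \<in> smooth V" by blast
    then have "Ck_on k E (\<phi> ` (U \<inter> V)) (f \<circ> inv_into U \<phi>)"
      using U by (auto simp: smooth_functions_def Cinf_on_def)
    with V y openin_chart_image[OF U V(1)]
    show "\<exists>T. openin (top_of_set E) T \<and> p \<in> T \<and> T \<subseteq> \<phi> ` (U \<inter> W) \<and> Ck_on k E T (f \<circ> inv_into U \<phi>)"
      by (intro exI[of _ "\<phi> ` (U \<inter> V)"]) blast
  qed
  moreover have "f y \<in> F" if "y \<in> W" for y
    using assms[OF that] by (auto simp: smooth_functions_def)
  ultimately show ?thesis by (auto simp: smooth_functions_def Cinf_on_def)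
qed

lemma smooth_zero: "(\<lambda>_. 0) \<in> smooth W"
  using scalars by (auto simp: smooth_functions_def Cinf_on_def comp_def Ck_on_const)

lemma smooth_add: "f \<in> smooth W \<Longrightarrow> g \<in> smooth W \<Longrightarrow> (\<lambda>y. f y + g y) \<in> smooth W"
  using scalars by (auto simp: smooth_functions_def Cinf_on_def comp_def intro!: Ck_on_add)

lemma smooth_mult: "f \<in> smooth W \<Longrightarrow> g \<in> smooth W \<Longrightarrow> (\<lambda>y. f y * g y) \<in> smooth W"
  using scalars by (auto simp: smooth_functions_def Cinf_on_def comp_def intro!: Ck_on_mult)

text \<open>The Hausdorff property enters here: the compact set K is closed, hence contains the
  closure of the set where f is nonzero.\<close>

lemma smooth_compactI:
  assumes "f \<in> smooth UNIV" "{y. f y \<noteq> 0} \<subseteq> K" "compact K" "K \<subseteq> U"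
  shows "f \<in> smooth_compact F E A U"
proof -
  have cl: "closure {y. f y \<noteq> 0} \<subseteq> K"
    using assms(2,3) by (intro closure_minimal compact_imp_closed)
  have "compact (K \<inter> closure {y. f y \<noteq> 0})" using assms(3) by (intro compact_Int_closed) simp_all
  then have "compact (closure {y. f y \<noteq> 0})" by (simp only: Int_absorb1[OF cl])
  then show ?thesis using assms(1) order_trans[OF cl assms(4)] by (simp add: smooth_compact_def)
qed

lemma smooth_compact_add:
  assumes f: "f \<in> smooth_compact F E A U" and g: "g \<in> smooth_compact F E A U"
  shows "(\<lambda>y. f y + g y) \<in> smooth_compact F E A U"
proof (rule smooth_compactI)
  let ?K = "closure {y. f y \<noteq> 0} \<union> closure {y. g y \<noteq> 0}"
  show "(\<lambda>y. f y + g y) \<in> smooth UNIV" "compact ?K" "?K \<subseteq> U"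
    using f g by (simp_all add: smooth_compact_def smooth_add compact_Un)
  have "{y. f y + g y \<noteq> 0} \<subseteq> {y. f y \<noteq> 0} \<union> {y. g y \<noteq> 0}" by auto
  also have "\<dots> \<subseteq> ?K" by (intro Un_mono closure_subset)
  finally show "{y. f y + g y \<noteq> 0} \<subseteq> ?K" .
qed

text \<open>The factor \<open>f\<close> is arbitrary outside \<open>U\<close>, where the other factor vanishes.\<close>

lemma smooth_compact_mult:
  assumes f: "f \<in> smooth U" and U: "open U" and g: "g \<in> smooth_compact F E A U"
  shows "(\<lambda>y. f y * g y) \<in> smooth_compact F E A U"
proof (rule smooth_compactI)
  define K where "K = closure {y. g y \<noteq> 0}"
  have gK: "g y = 0" if "y \<notin> K" for y
    using that closure_subset[of "{y. g y \<noteq> 0}"] unfolding K_def by blast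
  then show "{y. f y * g y \<noteq> 0} \<subseteq> K" by auto
  have g': "g \<in> smooth UNIV" and K: "K \<subseteq> U" "compact K" using g by (simp_all add: smooth_compact_def K_def)
  from K show "K \<subseteq> U" "compact K" .
  show "(\<lambda>y. f y * g y) \<in> smooth UNIV"
  proof (rule smooth_local)
    fix y
    show "\<exists>V. open V \<and> y \<in> V \<and> V \<subseteq> UNIV \<and> (\<lambda>y. f y * g y) \<in> smooth V"
    proof (cases "y \<in> U")
      case True
      with U smooth_mult[OF f smooth_subset[OF g' subset_UNIV]] show ?thesis
        by (intro exI[of _ U]) simp
    next
      case False
      have "(\<lambda>y. f y * g y) \<in> smooth (- K)"
        by (rule smooth_cong[OF smooth_zero]) (simp add: gK)
      moreover have "y \<notin> K" using False K(1) by (rule contra_subsetD[rotated])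
      ultimately show ?thesis by (intro exI[of _ "- K"]) (simp add: K_def open_Compl)
    qed
  qed
qed

text \<open>A bump function in a chart around x is extended by zero. The radius is chosen so that
  the closed ball, cut with E, lies in the image of V \<inter> U; its preimage K is then compact.
  The extension is smooth on V and vanishes on the complement of K, and these two sets are open, the
  latter by the Hausdorff property, and cover the manifold.\<close>

lemma smooth_compact_bump:
  assumes U: "open U" "x \<in> U"
  obtains f where "f \<in> smooth_compact F E A U" "germ x f = germ x (\<lambda>_. 1)"
proof -
  obtain V \<phi> where V: "(V, \<phi>) \<in> A" "x \<in> V" using chart_at .
  let ?i = "inv_into V \<phi>"
  obtain O' where O': "open O'" "\<phi> ` (V \<inter> U) = E \<inter> O'"
    using openin_chart_image[OF V(1) U(1)] by (auto simp: openin_open)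
  then have "\<phi> x \<in> O'" using V U by blast
  then obtain r where r: "r > 0" "cball (\<phi> x) r \<subseteq> O'" using O'(1) open_contains_cball by blast
  let ?B = "E \<inter> cball (\<phi> x) r"
  let ?K = "?i ` ?B"
  have B: "?B \<subseteq> \<phi> ` (V \<inter> U)" using O' r by blast
  have i: "continuous_on (\<phi> ` V) ?i" using homeomorphism_chart[OF V(1)] by (simp add: homeomorphism_def)
  have "compact ?B" using closed_subspace[OF subspace] by (simp add: closed_Int_compact)
  then have K: "compact ?K"
    by (rule compact_continuous_image[rotated]) (use i B in \<open>blast intro: continuous_on_subset\<close>)
  have KU: "?K \<subseteq> V \<inter> U" using B chart_inverse[OF V(1)] by force
  let ?h = "bump_function (\<phi> x) r"
  define f where "f = (\<lambda>y. if y \<in> V then of_real (?h (\<phi> y)) else 0 :: complex)"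
  have supp: "{y. f y \<noteq> 0} \<subseteq> ?K"
  proof
    fix y assume "y \<in> {y. f y \<noteq> 0}"
    then have y: "y \<in> V" "?h (\<phi> y) \<noteq> 0" by (auto simp: f_def split: if_splits)
    then have "\<phi> y \<in> cball (\<phi> x) r"
      using bump_function_eq_0[OF r(1)] ball_subset_cball by blast
    moreover have "\<phi> y \<in> E" using openin_imp_subset[OF openin_chart[OF V(1)]] y by blast
    ultimately show "y \<in> ?K" using chart_inverse[OF V(1) y(1)] by (metis IntI image_eqI)
  qed
  have "f \<in> smooth V"
  proof -
    \<comment> \<open>Smoothness has to hold in every chart of the atlas, not only in \<phi>. In the
      chart \<psi> the function is the bump function composed with the transition map.\<close>
    have "Ck_on k E (\<psi> ` (W \<inter> V)) (f \<circ> inv_into W \<psi>)" if W: "(W, \<psi>) \<in> A" for W \<psi> k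
    proof -
      have "Ck_on k E (\<psi> ` (W \<inter> V)) (\<lambda>p. complex_of_real (?h ((\<phi> \<circ> inv_into W \<psi>) p)))"
        using transition[OF W V(1)]
        by (intro Ck_on_bounded_linear[OF bounded_linear_of_real] Ck_on_bump_function)
          (simp add: Cinf_on_def comp_def)
      then show ?thesis
        by (subst Ck_on_cong[where g = "\<lambda>p. complex_of_real (?h ((\<phi> \<circ> inv_into W \<psi>) p))"])
          (use chart_inverse[OF W] in \<open>auto simp: f_def\<close>)
    qed
    then show ?thesis using scalars by (auto simp: smooth_functions_def Cinf_on_def f_def)
  qed
  have "f \<in> smooth UNIV"
  proof (rule smooth_local)
    fix y
    show "\<exists>V. open V \<and> y \<in> V \<and> V \<subseteq> UNIV \<and> f \<in> smooth V"
    proof (cases "y \<in> V")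
      case True
      with \<open>f \<in> smooth V\<close> open_chart[OF V(1)] show ?thesis by blast
    next
      case False
      have "f \<in> smooth (- ?K)"
        by (rule smooth_cong[OF smooth_zero]) (use supp in force)
      with False KU compact_imp_closed[OF K] show ?thesis
        by (intro exI[of _ "- ?K"]) auto
    qed
  qed
  then have "f \<in> smooth_compact F E A U" using smooth_compactI[OF _ supp K] KU by blast
  moreover have "germ x f = germ x (\<lambda>_. 1)"
  proof -
    have "continuous_on V \<phi>" using homeomorphism_chart[OF V(1)] by (simp add: homeomorphism_def)
    then have "open (\<phi> -` ball (\<phi> x) (r / 2) \<inter> V)"
      using open_chart[OF V(1)] by (simp add: continuous_on_open_vimage)
    moreover have "f y = 1" if "y \<in> \<phi> -` ball (\<phi> x) (r / 2) \<inter> V" for y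
      using that bump_function_eq_1[OF r(1)] by (auto simp: f_def)
    ultimately show ?thesis
      unfolding germ_eq_iff eventually_nhds using V r
      by (intro exI[of _ "\<phi> -` ball (\<phi> x) (r / 2) \<inter> V"]) auto
  qed
  ultimately show ?thesis using that by blast
qed

text \<open>A function defined near x only becomes an element of \<open>R\<close> with the same germ
  after multiplication by a bump function supported in its domain. Thus scalars in the stalk can
  always be lifted to \<open>R\<close>.\<close>

lemma smooth_germs_eq: "smooth_germs F E A x = germ x ` smooth_compact F E A UNIV"
proof (intro equalityI subsetI)
  fix \<gamma> assume "\<gamma> \<in> smooth_germs F E A x"
  then obtain f U where f: "\<gamma> = germ x f" "open U" "x \<in> U" "f \<in> smooth U"
    by (auto simp: smooth_germs_def)
  obtain g where g: "g \<in> smooth_compact F E A U" "germ x g = germ x (\<lambda>_. 1)"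
    using smooth_compact_bump[OF f(2,3)] .
  have "(\<lambda>y. f y * g y) \<in> smooth_compact F E A UNIV"
    using smooth_compact_mult[OF f(4,2) g(1)] by (auto simp: smooth_compact_def)
  moreover have "germ x (\<lambda>y. f y * g y) = \<gamma>"
    using g(2) unfolding f(1) germ_eq_iff by (rule eventually_mono) simp
  ultimately show "\<gamma> \<in> germ x ` smooth_compact F E A UNIV" by (metis imageI)
next
  fix \<gamma> assume "\<gamma> \<in> germ x ` smooth_compact F E A UNIV"
  then show "\<gamma> \<in> smooth_germs F E A x"
    by (auto simp: smooth_germs_def smooth_compact_def intro!: exI[of _ UNIV])
qed

end

section \<open>Coalgebras over compactly supported smooth functions\<close>

lemma (in manifold) function_coalgebra:
  assumes "coalgebra (smooth_compact_ring F E A) C \<Delta> \<epsilon>"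
  shows "function_coalgebra (smooth_compact_ring F E A) C \<Delta> \<epsilon>"
proof -
  interpret coalgebra "smooth_compact_ring F E A" C \<Delta> \<epsilon> by (rule assms)
  have "\<exists>f\<in>smooth_compact F E A UNIV. germ x f = germ x (\<lambda>_. 1) \<and> closure {y. f y \<noteq> 0} \<subseteq> U"
    if U: "open U" "x \<in> U" for U x
  proof -
    obtain f where "f \<in> smooth_compact F E A U" "germ x f = germ x (\<lambda>_. 1)"
      using smooth_compact_bump[OF U] .
    then show ?thesis by (auto simp: smooth_compact_def)
  qed
  moreover have "(\<lambda>y. f y * g y) \<in> smooth_compact F E A UNIV"
    if "f \<in> smooth_compact F E A UNIV" "g \<in> smooth_compact F E A UNIV" for f g
    using that by (intro smooth_compact_mult) (auto simp: smooth_compact_def)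
  ultimately show ?thesis
    by unfold_locales (auto simp: smooth_compact_ring_def smooth_compact_add)
qed

theorem proposition2p3:
  fixes F :: "complex set"
    and E :: "'e::euclidean_space set"
    and A :: "('m::t2_space, 'e) atlas"
    and R :: "('m \<Rightarrow> complex, 'm \<Rightarrow> complex) module"
    and C :: "('m \<Rightarrow> complex, 'c) module"
    and \<Delta> :: "'c \<Rightarrow> ('c \<times> 'c \<Rightarrow>\<^sub>0 int) set"
    and \<epsilon> :: "'c \<Rightarrow> 'm \<Rightarrow> complex"
    and x :: 'm
  assumes scalars: "F = \<real> \<or> F = UNIV"
    and manifold: "smooth_manifold E A"
    and R_def: "R = smooth_compact_ring F E A"
    and coalgebra: "coalgebra R C \<Delta> \<epsilon>"
  shows
    "(\<forall>c \<in> weakly_grouplike R C \<Delta>. normalized_on \<epsilon> c {x} \<longrightarrow>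
        stalk_elt R x C c \<in> stalk_grouplike R (smooth_germs F E A x) x C \<Delta> \<epsilon>)
     \<and>
     (\<forall>c \<in> weakly_grouplike R C \<Delta>. \<forall>d \<in> weakly_grouplike R C \<Delta>. \<forall>U V.
        open U \<longrightarrow> x \<in> U \<longrightarrow> open V \<longrightarrow> x \<in> V \<longrightarrow>
        normalized_on \<epsilon> c U \<longrightarrow> normalized_on \<epsilon> d V \<longrightarrow>
        stalk_elt R x C c = stalk_elt R x C d \<longrightarrow>
        (\<exists>W. open W \<and> x \<in> W \<and> W \<subseteq> U \<inter> V \<and>
          (\<forall>y\<in>W. stalk_elt R y C c = stalk_elt R y C d)))
     \<and>
     (\<forall>c \<in> carrier C.
        stalk_elt R x C c \<in> stalk_grouplike R (smooth_germs F E A x) x C \<Delta> \<epsilon> \<longrightarrow>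
        (\<exists>U. open U \<and> x \<in> U \<and> normalized_on \<epsilon> c U \<and>
          (\<exists>f \<in> smooth_compact F E A U. germ x f = germ x (\<lambda>_. 1) \<and>
             f \<odot>\<^bsub>C\<^esub> c \<in> weakly_grouplike R C \<Delta>)))"
proof -
  interpret manifold F E A using scalars manifold by unfold_locales
  interpret function_coalgebra R C \<Delta> \<epsilon>
    unfolding R_def using coalgebra by (intro function_coalgebra) (simp add: R_def)
  \<comment> \<open>Brings the ring of germs into the form over which the abstract results are
    stated.\<close>
  have germs: "smooth_germs F E A x = germs x"
    by (simp add: smooth_germs_eq R_def smooth_compact_ring_def)
  have nearby: "\<exists>W. open W \<and> x \<in> W \<and> W \<subseteq> U \<inter> V \<and> (\<forall>y\<in>W. stalk_of y c = stalk_of y d)"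
    if "c \<in> weakly_grouplike R C \<Delta>" "d \<in> weakly_grouplike R C \<Delta>"
      and UV: "open U" "x \<in> U" "open V" "x \<in> V" and eq: "stalk_of x c = stalk_of x d" for c d U V
  proof -
    have "c \<in> carrier C" "d \<in> carrier C" using that by (auto simp: weakly_grouplike_def)
    then obtain W where "open W" "x \<in> W" "\<And>y. y \<in> W \<Longrightarrow> stalk_of y c = stalk_of y d"
      using stalk_elt_eq_nearby[OF _ _ eq] by blast
    with UV show ?thesis by (intro exI[of _ "W \<inter> (U \<inter> V)"]) auto
  qed
  have local: "\<exists>U. open U \<and> x \<in> U \<and> normalized_on \<epsilon> c U \<and>
      (\<exists>f\<in>smooth_compact F E A U. germ x f = germ x (\<lambda>_. 1) \<and> f \<odot>\<^bsub>C\<^esub> c \<in> weakly_grouplike R C \<Delta>)"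
    if c: "c \<in> carrier C" "stalk_of x c \<in> stalk_grouplike R (germs x) x C \<Delta> \<epsilon>" for c
  proof -
    obtain U f where U: "open U" "x \<in> U" "normalized_on \<epsilon> c U"
      and f: "unit_at x f" "closure {y. f y \<noteq> 0} \<subseteq> U" "f \<odot>\<^bsub>C\<^esub> c \<in> weakly_grouplike R C \<Delta>"
      using weakly_grouplike_if_stalk_grouplike[OF c] .
    have germ: "germ x f = germ x (\<lambda>_. 1)" and fR: "f \<in> carrier R"
      using f(1) by (simp_all only: unit_at_def)
    have "carrier R = smooth_compact F E A UNIV" by (simp add: R_def smooth_compact_ring_def)
    with fR f(2) have "f \<in> smooth_compact F E A U" by (simp add: smooth_compact_def)
    with U f(3) germ show ?thesis by blast
  qed
  show ?thesis
    unfolding germs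
  proof (intro conjI ballI allI impI)
    fix c assume "c \<in> weakly_grouplike R C \<Delta>" "normalized_on \<epsilon> c {x}"
    then show "stalk_of x c \<in> stalk_grouplike R (germs x) x C \<Delta> \<epsilon>"
      by (intro stalk_grouplike_if_weakly_grouplike) (simp_all add: normalized_on_def)
  qed (rule nearby local; assumption)+
qed

end
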